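(* Let $n\ge 1$, let $\mu$ be a nonzero rectangle doubling measure on $\mathbb{R}^n$, let $0<\alpha<n$ and $1<p<q<\infty$. Let $\mathbf{I}_\alpha$ be the multi-parameter fractional integral operator associated with $\mu$, $$(\mathbf{I}_\alpha f)(x)=\int_{\mathbb{R}^n} f(y)\left(\frac{1}{\mathbf{V}(x,y)}\right)^{1-\frac{\alpha}{n}}d\mu(y).$$ Then there exists a finite constant $C=C_{p,q,\mu}$ such that $$\|\mathbf{I}_\alpha f\|_{L^q(\mathbb{R}^n,d\mu)}\le C\,\|f\|_{L^p(\mathbb{R}^n,d\mu)}\qquad\text{for all } f\in L^p(\mathbb{R}^n,d\mu)$$ (this includes the assertion that the integral defining $(\mathbf{I}_\alpha f)(x)$ converges absolutely for $\mu$-a.e. $x$) if and only if $$\frac{\alpha}{n}=\frac1p-\frac1q .$$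
   Context: Rectangle doubling: $\mu$ is an absolutely continuous measure, $d\mu(x)=\omega(x)\,dx$ with $\omega\ge 0$ locally integrable on $\mathbb{R}^n$, and there is $\gamma>0$ such that for every $i\in\{1,\dots,n\}$, every bounded interval $Q_i\subset\mathbb{R}$ and every $x_i'\in\mathbb{R}^{n-1}$ (the coordinates other than $x_i$), $$\int_{2Q_i}\omega(x_i,x_i')\,dx_i\le 2^{\gamma n}\int_{Q_i}\omega(x_i,x_i')\,dx_i,$$ where $2Q_i$ is the interval with the same center as $Q_i$ and twice its length. For $x\in\mathbb{R}^n$ and $\delta=(\delta_1,\dots,\delta_n)$ with $0<\delta_i<\infty$, let $\mathbf{Q}(x,\delta)=\prod_{i=1}^n\{y_i\in\mathbb{R}:|x_i-y_i|<\delta_i\}$. For $x,y\in\mathbb{R}^n$ let $$\mathbf{V}(x,y)=\inf_{\delta}\{\mu(\mathbf{Q}(x,\delta)) : y\in\mathbf{Q}(x,\delta)\},$$ the infimum being over all $\delta\in(0,\infty)^n$. (For fixed $x$, the set of $y$ with $y_i=x_i$ for some $i$ is $\mu$-null and is ignored.) *)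

theory Defs
  imports "HOL-Analysis.Analysis"
begin

definition axis_slice :: "(real^'n \<Rightarrow> real) \<Rightarrow> 'n \<Rightarrow> real^'n \<Rightarrow> real \<Rightarrow> real"
  where "axis_slice \<omega> i x' t = \<omega> (\<chi> j. if j = i then t else x' $ j)"

text \<open>
  A bounded interval is given by its centre \<open>c\<close> and half-length \<open>r\<close>; whether its
  endpoints belong to it does not affect the integrals. Of the vector \<open>x'\<close> only the coordinates
  other than the \<open>i\<close>-th are used. As \<open>\<omega> \<ge> 0\<close>, the one-dimensional integrals are taken in
  \<open>[0,\<infinity>]\<close>; a Lebesgue measurable \<open>\<omega>\<close> may have non-measurable slices, so measurability of the
  slices, without which these integrals have no meaning, is a separate clause.
\<close>

definition rectangle_doubling_weight :: "(real^'n \<Rightarrow> real) \<Rightarrow> bool"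
  where "rectangle_doubling_weight \<omega> \<longleftrightarrow>
    (\<forall>x. 0 \<le> \<omega> x) \<and>
    \<omega> \<in> borel_measurable lebesgue \<and>
    (\<forall>K. compact K \<longrightarrow> \<omega> absolutely_integrable_on K) \<and>
    (\<forall>i x'. axis_slice \<omega> i x' \<in> borel_measurable lebesgue) \<and>
    (\<exists>\<gamma>>0. \<forall>i x' c r. 0 < r \<longrightarrow>
      (\<integral>\<^sup>+t\<in>{c - 2 * r..c + 2 * r}. ennreal (axis_slice \<omega> i x' t) \<partial>lebesgue)
        \<le> ennreal (2 powr (\<gamma> * real CARD('n))) *
           (\<integral>\<^sup>+t\<in>{c - r..c + r}. ennreal (axis_slice \<omega> i x' t) \<partial>lebesgue))"

definition rectangle_doubling :: "(real^'n) measure \<Rightarrow> bool"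
  where "rectangle_doubling \<mu> \<longleftrightarrow>
    (\<exists>\<omega>. rectangle_doubling_weight \<omega> \<and> \<mu> = density lebesgue (\<lambda>x. ennreal (\<omega> x)))"

definition rect :: "real^'n \<Rightarrow> real^'n \<Rightarrow> (real^'n) set"
  where "rect x \<delta> = {y. \<forall>i. \<bar>x $ i - y $ i\<bar> < \<delta> $ i}"

definition rect_vol :: "(real^'n) measure \<Rightarrow> real^'n \<Rightarrow> real^'n \<Rightarrow> real"
  where "rect_vol \<mu> x y =
    Inf {measure \<mu> (rect x \<delta>) |\<delta>. (\<forall>i. 0 < \<delta> $ i) \<and> y \<in> rect x \<delta>}"

text \<open>
  Where \<open>rect_vol \<mu> x y = 0\<close> the kernel takes the value \<open>0\<close>, since \<open>1 / 0 = 0\<close>.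
  For a nonzero rectangle doubling \<open>\<mu>\<close> and fixed \<open>x\<close> this concerns only
  those \<open>y\<close> with \<open>y $ i = x $ i\<close> for some \<open>i\<close>, a null set.
\<close>

definition frac_integrand ::
    "(real^'n) measure \<Rightarrow> real \<Rightarrow> (real^'n \<Rightarrow> complex) \<Rightarrow> real^'n \<Rightarrow> real^'n \<Rightarrow> complex"
  where "frac_integrand \<mu> \<alpha> f x y =
    f y * complex_of_real ((1 / rect_vol \<mu> x y) powr (1 - \<alpha> / real CARD('n)))"

definition frac_integral ::
    "(real^'n) measure \<Rightarrow> real \<Rightarrow> (real^'n \<Rightarrow> complex) \<Rightarrow> real^'n \<Rightarrow> complex"
  where "frac_integral \<mu> \<alpha> f x = (\<integral>y. frac_integrand \<mu> \<alpha> f x y \<partial>\<mu>)"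

definition Lp_space :: "'a measure \<Rightarrow> real \<Rightarrow> ('a \<Rightarrow> complex) set"
  where "Lp_space M p =
    {f. f \<in> borel_measurable M \<and> integrable M (\<lambda>x. norm (f x) powr p)}"

definition Lp_norm :: "'a measure \<Rightarrow> real \<Rightarrow> ('a \<Rightarrow> complex) \<Rightarrow> real"
  where "Lp_norm M p f = (\<integral>x. norm (f x) powr p \<partial>M) powr (1 / p)"

end

theory Submission
  imports Defs
begin

text \<open>
  Write \<open>a = \<alpha>/n\<close>. Doubling bounds the kernel by \<open>\<Sum> \<mu>(Q)\<^sup>a\<^sup>-\<^sup>1 1\<^sub>Q(x) 1\<^sub>Q\<^sub>'(y)\<close>, summed over all dyadic
  rectangles \<open>Q\<close> and their finitely many neighbours \<open>Q'\<close> of the same side lengths. When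
  \<open>a = 1/p - 1/q\<close>, duality and Hoelder's inequality with an exponent \<open>r\<close>, \<open>p < r < q\<close>, reduce the
  \<open>L\<^sup>p \<rightarrow> L\<^sup>q\<close> bound to the embedding
  \<open>\<Sum>\<^sub>Q (\<mu>(Q)\<^sup>1\<^sup>/\<^sup>p\<^sup>-\<^sup>1 \<integral>\<^sub>Q g d\<mu>)\<^sup>r \<le> C \<parallel>g\<parallel>\<^sub>p\<^sup>r\<close>, used once for \<open>(p, r)\<close> and once for the conjugate exponents
  \<open>(q', r')\<close>. The embedding tensorises: it is proved in one coordinate, the sides in the other
  coordinates being fixed, and Minkowski's inequality in \<open>\<ell>\<^sup>r\<^sup>/\<^sup>p\<close> iterates it over the coordinates. In one
  coordinate it follows from the geometric growth of \<open>\<mu>(Q)\<close> along a chain of dyadic intervals.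

  Conversely, on the indicator of a dyadic cube \<open>Q\<close> the operator is at least \<open>c \<mu>(Q)\<^sup>a\<close>
  throughout \<open>Q\<close>, so \<open>\<mu>(Q)\<close> raised to the power \<open>a + 1/q - 1/p\<close> is bounded; as \<open>\<mu>(Q)\<close> takes arbitrarily small and
  arbitrarily large values, this exponent must vanish.
\<close>

section \<open>Inequalities for finite sums\<close>

text \<open>The density of \<open>\<mu>\<close> need not be a product and the sides of a rectangle
  vary independently, so the problem does not split into one-parameter problems. Two facts replace
  the product structure: doubling in one coordinate holds with the same constant whatever is fixed
  in the others, and the mass of a cell, like the integral of \<open>g\<close> over it, is additive
  along each coordinate. The one-coordinate inequality rests on these, so its constant is the same
  for every choice of the other sides and it may be applied inside the sum over them. The strict
  inequality \<open>p < r\<close> cannot be relaxed in the embedding: for \<open>r = p\<close> and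
  \<open>g\<close> the indicator of a dyadic rectangle, every choice of smaller side lengths
  contributes the same amount, the mass of that rectangle. The gap between \<open>p\<close> and
  \<open>q\<close> leaves room for an exponent that is strict on both sides of the duality. All
  estimates are made for finite families of cells, with constants that do not depend on the family;
  this keeps every integral finite until monotone convergence passes to all cells.\<close>

lemma Holder_sum:
  fixes a b :: "'a \<Rightarrow> real"
  assumes fin: "finite A" and pq: "p > 1" "q > 1" "1 / p + 1 / q = 1"
    and nn: "\<And>x. x \<in> A \<Longrightarrow> 0 \<le> a x" "\<And>x. x \<in> A \<Longrightarrow> 0 \<le> b x"
  shows "(\<Sum>x\<in>A. a x * b x) \<le> (\<Sum>x\<in>A. a x powr p) powr (1 / p) * (\<Sum>x\<in>A. b x powr q) powr (1 / q)"
proof -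
  define P where "P = (\<Sum>x\<in>A. a x powr p)"
  define Q where "Q = (\<Sum>x\<in>A. b x powr q)"
  have P0: "0 \<le> P" and Q0: "0 \<le> Q" by (auto simp: P_def Q_def intro: sum_nonneg)
  show ?thesis
  proof (cases "P = 0 \<or> Q = 0")
    case True
    then have "\<forall>x\<in>A. a x * b x = 0"
      using fin by (auto simp: P_def Q_def sum_nonneg_eq_0_iff)
    then have "(\<Sum>x\<in>A. a x * b x) = 0" by (rule sum.neutral)
    then show ?thesis by simp
  next
    case False
    with P0 Q0 have pos: "P > 0" "Q > 0" by auto
    define s where "s = P powr (1 / p)"
    define t where "t = Q powr (1 / q)"
    have st: "s > 0" "t > 0" "s powr p = P" "t powr q = Q"
      using pos pq by (auto simp: s_def t_def powr_powr)
    have "(\<Sum>x\<in>A. (a x / s) * (b x / t)) \<le> (\<Sum>x\<in>A. (a x / s) powr p / p + (b x / t) powr q / q)"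
      using nn st pq by (intro sum_mono Youngs_inequality) auto
    also have "\<dots> = (\<Sum>x\<in>A. a x powr p / P / p + b x powr q / Q / q)"
      using nn st by (intro sum.cong) (auto simp: powr_divide)
    also have "\<dots> = P / P / p + Q / Q / q"
      by (simp only: sum.distrib P_def Q_def flip: sum_divide_distrib)
    also have "\<dots> = 1" using pos pq by simp
    finally have "(\<Sum>x\<in>A. a x * b x / (s * t)) \<le> 1" by simp
    then have "(\<Sum>x\<in>A. a x * b x) / (s * t) \<le> 1" by (simp add: sum_divide_distrib)
    then show ?thesis using st by (simp add: field_simps s_def t_def P_def Q_def)
  qed
qed

text \<open>The triangle inequality of the sequence space with exponent \<open>s\<close>, for the
  vectors \<open>b _ y\<close>; it serves to move a sum outside an \<open>s\<close>-th power. One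
  factor \<open>G x\<close> of \<open>G x powr s\<close> is expanded, Hoelder's inequality is
  applied for each \<open>y\<close>, and the common factor \<open>I powr (1 - 1 / s)\<close> is
  cancelled.\<close>

lemma Minkowski_sum:
  fixes b :: "'a \<Rightarrow> 'b \<Rightarrow> real"
  assumes fin: "finite A" "finite B" and s: "s > 1"
    and nn: "\<And>x y. x \<in> A \<Longrightarrow> y \<in> B \<Longrightarrow> 0 \<le> b x y"
  shows "(\<Sum>x\<in>A. (\<Sum>y\<in>B. b x y) powr s) \<le> (\<Sum>y\<in>B. (\<Sum>x\<in>A. b x y powr s) powr (1 / s)) powr s"
proof -
  define G where "G x = (\<Sum>y\<in>B. b x y)" for x
  define I where "I = (\<Sum>x\<in>A. G x powr s)"
  define J where "J = (\<Sum>y\<in>B. (\<Sum>x\<in>A. b x y powr s) powr (1 / s))"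
  have G0: "0 \<le> G x" if "x \<in> A" for x using that nn by (auto simp: G_def intro: sum_nonneg)
  have I0: "0 \<le> I" by (auto simp: I_def intro: sum_nonneg)
  have J0: "0 \<le> J" by (auto simp: J_def intro: sum_nonneg)
  define s' where "s' = s / (s - 1)"
  have s': "s' > 1" "1 / s + 1 / s' = 1" "(s - 1) * s' = s" "1 / s' = 1 - 1 / s"
    using s by (auto simp: s'_def field_simps)
  have "I = (\<Sum>x\<in>A. \<Sum>y\<in>B. b x y * G x powr (s - 1))"
  proof -
    have "G x powr s = (\<Sum>y\<in>B. b x y * G x powr (s - 1))" if "x \<in> A" for x
    proof -
      have "G x powr s = G x * G x powr (s - 1)"
        using G0[OF that] s by (cases "G x = 0") (auto simp: powr_diff)
      then show ?thesis by (simp add: G_def sum_distrib_right)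
    qed
    then show ?thesis by (simp add: I_def)
  qed
  also have "\<dots> = (\<Sum>y\<in>B. \<Sum>x\<in>A. b x y * G x powr (s - 1))" by (rule sum.swap)
  also have "\<dots> \<le> (\<Sum>y\<in>B. (\<Sum>x\<in>A. b x y powr s) powr (1 / s) * (\<Sum>x\<in>A. (G x powr (s - 1)) powr s') powr (1 / s'))"
    using fin s s' nn by (intro sum_mono Holder_sum) auto
  also have "\<dots> = J * I powr (1 - 1 / s)"
    by (simp add: powr_powr s' J_def I_def sum_distrib_right)
  finally have *: "I \<le> J * I powr (1 - 1 / s)" .
  have "I \<le> J powr s"
  proof (cases "I = 0")
    case False
    with I0 have "I > 0" by simp
    then have "I powr (1 - 1 / s) > 0" by simp
    moreover have "I = I powr (1 / s) * I powr (1 - 1 / s)"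
      using \<open>I > 0\<close> by (simp flip: powr_add)
    ultimately have "I powr (1 / s) \<le> J" using * by (metis mult_le_cancel_right_pos)
    then have "(I powr (1 / s)) powr s \<le> J powr s" using s by (intro powr_mono2) auto
    then show ?thesis using s I0 by (simp add: powr_powr)
  qed simp
  then show ?thesis by (simp add: I_def J_def G_def)
qed

text \<open>Telescoping replaces a splitting of the sum where \<open>x k\<close> passes 1. The
  function \<open>\<psi>\<close> increases with values between 0 and 1, and when \<open>t\<close>
  grows at least by the factor \<open>R\<close>, its increment is at least a fixed multiple of
  \<open>t / (1 + t) ^ 2\<close>, which is comparable to \<open>min t (1 / t)\<close>. The 4 is the
  constant of this comparison.\<close>

lemma sum_min_geometric:
  fixes x :: "nat \<Rightarrow> real"
  assumes R: "R > 1" and pos: "\<And>k. 0 < x k" and grow: "\<And>k. R * x k \<le> x (Suc k)"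
  shows "(\<Sum>k<n. min (x k) (1 / x k)) \<le> 4 * R / (R - 1)"
proof -
  define \<psi> where "\<psi> t = t / (1 + t)" for t :: real
  have "min (x k) (1 / x k) \<le> 4 * R / (R - 1) * (\<psi> (x (Suc k)) - \<psi> (x k))" for k
  proof -
    define t where "t = x k"
    have t: "t > 0" using pos by (simp add: t_def)
    have "\<psi> (R * t) \<le> \<psi> (x (Suc k))"
      using grow[of k] t R pos[of "Suc k"]
      by (auto simp: \<psi>_def t_def divide_simps algebra_simps add_pos_pos intro: add_pos_pos) 
    moreover have "\<psi> (R * t) - \<psi> t = (R - 1) * t / ((1 + R * t) * (1 + t))"
    proof -
      have "1 + R * t > 0" using t R by (simp add: add_pos_pos)
      then show ?thesis using t by (simp add: \<psi>_def field_simps)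
    qed
    moreover have "(R - 1) * t / ((1 + R * t) * (1 + t)) \<ge> (R - 1) * t / (R * (1 + t) * (1 + t))"
    proof (rule divide_left_mono)
      show "(1 + R * t) * (1 + t) \<le> R * (1 + t) * (1 + t)"
        using t R by (intro mult_right_mono) (auto simp: algebra_simps)
      show "0 < R * (1 + t) * (1 + t) * ((1 + R * t) * (1 + t))"
        using t R by (intro mult_pos_pos add_pos_pos) auto
    qed (use t R in auto)
    ultimately have 1: "(R - 1) * t / (R * (1 + t) * (1 + t)) \<le> \<psi> (x (Suc k)) - \<psi> t" by linarith
    have "min t (1 / t) \<le> 4 * t / ((1 + t) * (1 + t))"
    proof (cases "t \<le> 1")
      case True
      have "(1 + t) * (1 + t) \<le> 2 * 2" using t True by (intro mult_mono) auto
      then have "t * ((1 + t) * (1 + t)) \<le> t * 4" using t by (intro mult_left_mono) auto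
      then have "t \<le> 4 * t / ((1 + t) * (1 + t))" using t by (simp add: pos_le_divide_eq mult.commute)
      then show ?thesis by linarith
    next
      case False
      have "(1 + t) * (1 + t) \<le> (2 * t) * (2 * t)" using t False by (intro mult_mono) auto
      then have "1 / t \<le> 4 * t / ((1 + t) * (1 + t))" using t by (simp add: divide_simps)
      then show ?thesis by linarith
    qed
    also have "\<dots> = 4 * R / (R - 1) * ((R - 1) * t / (R * (1 + t) * (1 + t)))"
    proof -
      have "R * ((R - 1) * t) / ((R - 1) * (R * (1 + t) * (1 + t))) = t / ((1 + t) * (1 + t))"
        using R t by (simp add: mult.assoc mult.left_commute[of R])
      then show ?thesis using R t by (simp add: mult.assoc)
    qed
    also have "\<dots> \<le> 4 * R / (R - 1) * (\<psi> (x (Suc k)) - \<psi> t)"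
      using 1 R by (intro mult_left_mono) auto
    finally show ?thesis by (simp add: t_def)
  qed
  then have "(\<Sum>k<n. min (x k) (1 / x k)) \<le> (\<Sum>k<n. 4 * R / (R - 1) * (\<psi> (x (Suc k)) - \<psi> (x k)))"
    by (intro sum_mono)
  also have "\<dots> = 4 * R / (R - 1) * (\<psi> (x n) - \<psi> (x 0))"
    by (simp only: sum_lessThan_telescope[of "\<lambda>k. \<psi> (x k)"] flip: sum_distrib_left)
  also have "\<dots> \<le> 4 * R / (R - 1) * 1"
  proof (rule mult_left_mono)
    have "\<psi> (x n) \<le> 1" "0 \<le> \<psi> (x 0)" using pos[of n] pos[of 0] by (auto simp: \<psi>_def divide_simps)
    then show "\<psi> (x n) - \<psi> (x 0) \<le> 1" by linarith
  qed (use R in auto)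
  finally show ?thesis by simp
qed

text \<open>The maximal function is avoided: at least half of \<open>\<integral>\<^sub>u g\<close> comes from points where \<open>g\<close> is at
  least half its average over \<open>u\<close>. At such a point \<open>t\<close> the average is bounded both by \<open>2 g(t)\<close>
  and, by Hoelder, by \<open>\<parallel>g\<parallel>\<^sub>p V(u)\<^sup>-\<^sup>1\<^sup>/\<^sup>p\<close>, so the sum over all \<open>u\<close> containing \<open>t\<close> is
  geometric on either side of \<open>V(u) = (\<parallel>g\<parallel>\<^sub>p / g(t))\<^sup>p\<close>.\<close>

lemma one_parameter_embedding:
  fixes \<nu> g :: "'t \<Rightarrow> real" and S :: "'u \<Rightarrow> 't set" and T :: "'t set"
  assumes fin: "finite U" "finite T" and S: "\<And>u. u \<in> U \<Longrightarrow> S u \<subseteq> T" "\<And>u. u \<in> U \<Longrightarrow> S u \<noteq> {}"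
    and \<nu>: "\<And>t. t \<in> T \<Longrightarrow> 0 < \<nu> t" and g: "\<And>t. t \<in> T \<Longrightarrow> 0 \<le> g t"
    and p: "1 < p" and r: "p < r"
    and \<kappa>: "0 < \<kappa>" "\<kappa> \<le> r / p - 1" "\<kappa> \<le> 1 - 1 / p"
    and V: "\<And>u. u \<in> U \<Longrightarrow> V u = (\<Sum>t\<in>S u. \<nu> t)"
    and geo: "\<And>t c. t \<in> T \<Longrightarrow> 0 < c \<Longrightarrow>
      (\<Sum>u\<in>{u\<in>U. t \<in> S u}. min ((V u / c) powr \<kappa>) (1 / (V u / c) powr \<kappa>)) \<le> C0"
  shows "(\<Sum>u\<in>U. (V u powr (1 / p - 1) * (\<Sum>t\<in>S u. g t * \<nu> t)) powr r)
    \<le> 2 powr r * C0 * (\<Sum>t\<in>T. g t powr p * \<nu> t) powr (r / p)"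
proof -
  define N where "N = (\<Sum>t\<in>T. g t powr p * \<nu> t) powr (1 / p)"
  define h where "h u = (\<Sum>t\<in>S u. g t * \<nu> t) / V u" for u
  have finS: "finite (S u)" if "u \<in> U" for u using S(1)[OF that] fin(2) by (rule finite_subset)
  have V0: "0 < V u" if "u \<in> U" for u
    unfolding V[OF that] using that S finS \<nu> by (intro sum_pos) (auto simp: subset_iff)
  have sum0: "0 \<le> (\<Sum>t\<in>T. g t powr p * \<nu> t)" using \<nu> by (intro sum_nonneg) (auto simp: less_imp_le)
  have N0: "0 \<le> N" by (simp add: N_def)
  have Np: "N powr p = (\<Sum>t\<in>T. g t powr p * \<nu> t)" using p sum0 by (simp add: N_def powr_powr)
  have Nr: "(\<Sum>t\<in>T. g t powr p * \<nu> t) powr (r / p) = N powr r"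
    by (simp add: N_def powr_powr)
  have hV: "(\<Sum>t\<in>S u. g t * \<nu> t) = V u * h u" if "u \<in> U" for u
    using V0[OF that] by (simp add: h_def)
  have gS: "0 \<le> g t * \<nu> t" if "t \<in> T" for t using g[OF that] \<nu>[OF that] by simp
  have h0: "0 \<le> h u" if "u \<in> U" for u
    using V0[OF that] S(1)[OF that] gS by (auto simp: h_def intro!: divide_nonneg_pos sum_nonneg)
  have summand: "(V u powr (1 / p - 1) * (\<Sum>t\<in>S u. g t * \<nu> t)) powr r = V u powr (r / p) * h u powr r"
    if "u \<in> U" for u
  proof -
    have "V u powr (1 / p - 1) * (V u * h u) = V u powr (1 / p) * h u"
      using V0[OF that] by (simp add: powr_diff)
    then show ?thesis unfolding hV[OF that] using h0[OF that] by (simp only:) (simp add: powr_mult powr_powr)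
  qed
  define p' where "p' = p / (p - 1)"
  have p': "p' > 1" "1 / p + 1 / p' = 1" using p by (auto simp: p'_def field_simps)
  have hN: "h u \<le> N * V u powr (- 1 / p)" if u: "u \<in> U" for u
  proof -
    have "V u * h u = (\<Sum>t\<in>S u. (g t * \<nu> t powr (1 / p)) * \<nu> t powr (1 / p'))"
      unfolding hV[OF u, symmetric] mult.assoc using p' \<nu> S(1)[OF u]
      by (intro sum.cong refl) (auto simp: subset_iff less_imp_le simp flip: powr_add)
    also have "\<dots> \<le> (\<Sum>t\<in>S u. (g t * \<nu> t powr (1 / p)) powr p) powr (1 / p) * (\<Sum>t\<in>S u. (\<nu> t powr (1 / p')) powr p') powr (1 / p')"
      using finS[OF u] p p' g S(1)[OF u] by (intro Holder_sum) auto
    also have "(\<Sum>t\<in>S u. (g t * \<nu> t powr (1 / p)) powr p) = (\<Sum>t\<in>S u. g t powr p * \<nu> t)"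
      using p \<nu> g S(1)[OF u] by (intro sum.cong refl) (auto simp: powr_mult powr_powr subset_iff less_imp_le)
    also have "(\<Sum>t\<in>S u. (\<nu> t powr (1 / p')) powr p') = V u"
      using p' \<nu> S(1)[OF u] by (simp add: V[OF u] powr_powr subset_iff less_imp_le cong: sum.cong)
    also have "(\<Sum>t\<in>S u. g t powr p * \<nu> t) powr (1 / p) \<le> N"
      unfolding N_def using p fin S(1)[OF u] \<nu>
      by (intro powr_mono2 sum_mono2 sum_nonneg) (auto simp: subset_iff less_imp_le)
    finally have "V u * h u \<le> N * V u powr (1 / p')" by (simp add: mult_right_mono)
    also have "\<dots> = V u * (N * V u powr (- 1 / p))"
    proof -
      have "1 / p' = 1 + - 1 / p" using p' by simp
      then show ?thesis using V0[OF u] by (simp only: powr_add) simp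
    qed
    finally show ?thesis using V0[OF u] by (simp only: mult_le_cancel_left_pos)
  qed
  have half: "V u * h u \<le> 2 * (\<Sum>t\<in>{t\<in>S u. h u \<le> 2 * g t}. g t * \<nu> t)" if u: "u \<in> U" for u
  proof -
    have "(\<Sum>t\<in>S u. g t * \<nu> t) = (\<Sum>t\<in>{t\<in>S u. h u \<le> 2 * g t}. g t * \<nu> t) + (\<Sum>t\<in>{t\<in>S u. \<not> h u \<le> 2 * g t}. g t * \<nu> t)"
      using finS[OF u] by (subst sum.union_disjoint[symmetric]) (auto intro!: sum.cong)
    also have "(\<Sum>t\<in>{t\<in>S u. \<not> h u \<le> 2 * g t}. g t * \<nu> t) \<le> (\<Sum>t\<in>{t\<in>S u. \<not> h u \<le> 2 * g t}. h u / 2 * \<nu> t)"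
      using \<nu> S(1)[OF u] by (intro sum_mono mult_right_mono) (auto simp: subset_iff less_imp_le)
    also have "\<dots> \<le> (\<Sum>t\<in>S u. h u / 2 * \<nu> t)"
      using \<nu> S(1)[OF u] finS[OF u] h0[OF u] by (intro sum_mono2) (auto simp: subset_iff less_imp_le)
    also have "\<dots> = h u * V u / 2" by (simp add: V[OF u] sum_distrib_left sum_divide_distrib)
    finally show ?thesis unfolding hV[OF u] mult.commute[of "h u"] by linarith
  qed
  have inner: "(\<Sum>u\<in>{u\<in>U. t \<in> S u \<and> h u \<le> 2 * g t}. V u powr (r / p - 1) * h u powr (r - 1))
      \<le> 2 powr (r - 1) * C0 * N powr (r - p) * g t powr (p - 1)" if t: "t \<in> T" and gt: "0 < g t" for t
  proof -
    have Npos: "0 < N"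
    proof -
      have "0 < g t powr p * \<nu> t" using \<nu>[OF t] gt by simp
      also have "\<dots> \<le> N powr p" unfolding Np
        using t fin \<nu> by (intro member_le_sum) (auto simp: less_imp_le)
      finally show ?thesis using N0 by (cases "N = 0") auto
    qed
    define c where "c = (N / g t) powr p"
    have c: "c > 0" using Npos gt by (simp add: c_def)
    define K where "K = 2 powr (r - 1) * (N powr (r - p) * g t powr (p - 1))"
    have "V u powr (r / p - 1) * h u powr (r - 1) \<le> K * min ((V u / c) powr \<kappa>) (1 / (V u / c) powr \<kappa>)"
      if u: "u \<in> U" and hu: "h u \<le> 2 * g t" for u
    proof -
      define s where "s = V u / c"
      have s: "s > 0" using V0[OF u] c by (simp add: s_def)
      have Vs: "V u = s * c" using c by (simp add: s_def)
      have cp: "c powr (r / p - 1) = N powr (r - p) / g t powr (r - p)"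
      proof -
        have "p * (r / p - 1) = r - p" using p by (simp add: algebra_simps)
        then show ?thesis using Npos gt by (simp add: c_def powr_powr powr_divide)
      qed
      have gg: "g t powr (r - 1) = g t powr (r - p) * g t powr (p - 1)"
        by (simp flip: powr_add)
      \<comment> \<open>In terms of \<open>s = V u / c\<close> the two bounds on the average turn
        into powers of \<open>s\<close> with exponents \<open>r / p - 1 > 0\<close> and
        \<open>1 / p - 1 < 0\<close>. As \<open>\<kappa>\<close> exceeds neither in absolute value,
        \<open>b1\<close> gives the decay for \<open>s \<le> 1\<close> and \<open>b2\<close> for
        \<open>s > 1\<close>.\<close>
      have b1: "V u powr (r / p - 1) * h u powr (r - 1) \<le> K * s powr (r / p - 1)"
      proof -
        have "h u powr (r - 1) \<le> (2 * g t) powr (r - 1)"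
          using hu h0[OF u] p r by (intro powr_mono2) auto
        also have "\<dots> = 2 powr (r - 1) * g t powr (r - 1)" using gt by (simp add: powr_mult)
        finally have "V u powr (r / p - 1) * h u powr (r - 1) \<le> (s powr (r / p - 1) * c powr (r / p - 1)) * (2 powr (r - 1) * g t powr (r - 1))"
          using s c by (simp add: Vs powr_mult mult_left_mono)
        also have "\<dots> = K * s powr (r / p - 1)" using gt unfolding cp gg K_def by simp
        finally show ?thesis .
      qed
      have b2: "V u powr (r / p - 1) * h u powr (r - 1) \<le> K * s powr (1 / p - 1)"
      proof -
        have "h u \<le> N * V u powr (- 1 / p)" by (rule hN[OF u])
        also have "\<dots> = g t * s powr (- 1 / p)"
        proof -
          have "c powr (- 1 / p) = g t / N"
            using p Npos gt by (simp add: c_def powr_powr powr_minus field_simps)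
          then show ?thesis using s c Npos by (simp add: Vs powr_mult)
        qed
        finally have "h u powr (r - 1) \<le> (g t * s powr (- 1 / p)) powr (r - 1)"
          using h0[OF u] p r by (intro powr_mono2) auto
        also have "\<dots> = 1 * g t powr (r - 1) * s powr (- (r - 1) / p)"
        proof -
          have "- 1 / p * (r - 1) = - (r - 1) / p" using p by (simp add: field_simps)
          then show ?thesis using gt by (simp only: powr_powr powr_mult mult_1)
        qed
        \<comment> \<open>The factor is inserted so that both bounds share the constant
          \<open>K\<close>.\<close>
        also have "\<dots> \<le> 2 powr (r - 1) * g t powr (r - 1) * s powr (- (r - 1) / p)"
          using r p by (intro mult_right_mono ge_one_powr_ge_zero) auto
        finally have "V u powr (r / p - 1) * h u powr (r - 1) \<le> (s powr (r / p - 1) * c powr (r / p - 1)) * (2 powr (r - 1) * g t powr (r - 1) * s powr (- (r - 1) / p))"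
          using s c by (simp add: Vs powr_mult mult_left_mono)
        also have "\<dots> = K * (s powr (r / p - 1) * s powr (- (r - 1) / p))" using gt unfolding cp gg K_def by simp
        also have "s powr (r / p - 1) * s powr (- (r - 1) / p) = s powr (1 / p - 1)"
        proof -
          have "r / p - 1 + - (r - 1) / p = 1 / p - 1" using p by (simp add: field_simps)
          then show ?thesis by (simp only: flip: powr_add)
        qed
        finally show ?thesis .
      qed
      have K0: "0 \<le> K" by (simp add: K_def)
      have "V u powr (r / p - 1) * h u powr (r - 1) \<le> K * min (s powr \<kappa>) (1 / s powr \<kappa>)"
      proof (cases "s \<le> 1")
        case True
        have a: "s powr (r / p - 1) \<le> s powr \<kappa>" using True s \<kappa> by (intro powr_mono') auto
        have "s powr \<kappa> \<le> 1" using True s \<kappa> by (intro powr_le1) auto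
        then have "s powr \<kappa> \<le> 1 / s powr \<kappa>" using s by (simp add: pos_le_divide_eq mult_le_one)
        then have m: "min (s powr \<kappa>) (1 / s powr \<kappa>) = s powr \<kappa>" by simp
        show ?thesis unfolding m using b1 mult_left_mono[OF a K0] by (rule order_trans)
      next
        case False
        have "s powr (1 / p - 1) \<le> s powr (- \<kappa>)" using False \<kappa> by (intro powr_mono) auto
        then have a: "s powr (1 / p - 1) \<le> 1 / s powr \<kappa>" by (simp add: powr_minus_divide)
        have "1 \<le> s powr \<kappa>" using False \<kappa> by (intro ge_one_powr_ge_zero) auto
        then have "1 / s powr \<kappa> \<le> s powr \<kappa>" 
          using mult_mono[of 1 "s powr \<kappa>" 1 "s powr \<kappa>"] s by (simp add: pos_divide_le_eq)
        then have m: "min (s powr \<kappa>) (1 / s powr \<kappa>) = 1 / s powr \<kappa>" by simp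
        show ?thesis unfolding m using b2 mult_left_mono[OF a K0] by (rule order_trans)
      qed
      then show ?thesis by (simp add: s_def)
    qed
    then have "(\<Sum>u\<in>{u\<in>U. t \<in> S u \<and> h u \<le> 2 * g t}. V u powr (r / p - 1) * h u powr (r - 1))
      \<le> (\<Sum>u\<in>{u\<in>U. t \<in> S u \<and> h u \<le> 2 * g t}. K * min ((V u / c) powr \<kappa>) (1 / (V u / c) powr \<kappa>))"
      by (intro sum_mono) auto
    also have "\<dots> \<le> (\<Sum>u\<in>{u\<in>U. t \<in> S u}. K * min ((V u / c) powr \<kappa>) (1 / (V u / c) powr \<kappa>))"
      using fin by (intro sum_mono2) (auto simp: K_def)
    also have "\<dots> = K * (\<Sum>u\<in>{u\<in>U. t \<in> S u}. min ((V u / c) powr \<kappa>) (1 / (V u / c) powr \<kappa>))"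
      by (simp add: sum_distrib_left)
    also have "\<dots> \<le> K * C0" using geo[OF t c] by (intro mult_left_mono) (auto simp: K_def)
    finally show ?thesis by (simp add: K_def mult_ac)
  qed
  have "(\<Sum>u\<in>U. (V u powr (1 / p - 1) * (\<Sum>t\<in>S u. g t * \<nu> t)) powr r)
     = (\<Sum>u\<in>U. V u powr (r / p) * h u powr r)" using summand by simp
  \<comment> \<open>One power of the integral \<open>V u * h u\<close> is kept apart. It alone is
    replaced by its large part and unfolded into a sum over \<open>t\<close>, after which the order
    of summation can be exchanged.\<close>
  also have "\<dots> = (\<Sum>u\<in>U. (V u powr (r / p - 1) * h u powr (r - 1)) * (V u * h u))"
  proof (intro sum.cong refl)
    fix u assume u: "u \<in> U"
    show "V u powr (r / p) * h u powr r = (V u powr (r / p - 1) * h u powr (r - 1)) * (V u * h u)"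
      using V0[OF u] h0[OF u] by (cases "h u = 0") (auto simp: powr_diff)
  qed
  also have "\<dots> \<le> (\<Sum>u\<in>U. (V u powr (r / p - 1) * h u powr (r - 1)) * (2 * (\<Sum>t\<in>{t\<in>S u. h u \<le> 2 * g t}. g t * \<nu> t)))"
    using half by (intro sum_mono mult_left_mono) auto
  also have "\<dots> = 2 * (\<Sum>u\<in>U. \<Sum>t\<in>{t\<in>S u. h u \<le> 2 * g t}. (V u powr (r / p - 1) * h u powr (r - 1)) * (g t * \<nu> t))"
    by (simp add: sum_distrib_left mult_ac)
  also have "\<dots> = 2 * (\<Sum>u\<in>U. \<Sum>t\<in>{t\<in>T. t \<in> S u \<and> h u \<le> 2 * g t}. (V u powr (r / p - 1) * h u powr (r - 1)) * (g t * \<nu> t))"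
    using S(1) by (intro arg_cong[where f="\<lambda>x. 2 * x"] sum.cong) auto
  also have "\<dots> = 2 * (\<Sum>t\<in>T. \<Sum>u\<in>{u\<in>U. t \<in> S u \<and> h u \<le> 2 * g t}. (V u powr (r / p - 1) * h u powr (r - 1)) * (g t * \<nu> t))"
    using fin by (subst sum.swap_restrict) auto
  also have "\<dots> = 2 * (\<Sum>t\<in>T. (\<Sum>u\<in>{u\<in>U. t \<in> S u \<and> h u \<le> 2 * g t}. V u powr (r / p - 1) * h u powr (r - 1)) * (g t * \<nu> t))"
    by (simp add: sum_distrib_right)
  also have "\<dots> \<le> 2 * (\<Sum>t\<in>T. 2 powr (r - 1) * C0 * N powr (r - p) * (g t powr p * \<nu> t))"
  proof (intro mult_left_mono sum_mono)
    fix t assume t: "t \<in> T"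
    show "(\<Sum>u\<in>{u\<in>U. t \<in> S u \<and> h u \<le> 2 * g t}. V u powr (r / p - 1) * h u powr (r - 1)) * (g t * \<nu> t)
      \<le> 2 powr (r - 1) * C0 * N powr (r - p) * (g t powr p * \<nu> t)"
    proof (cases "g t = 0")
      case False
      with g[OF t] have gt: "0 < g t" by simp
      have "(\<Sum>u\<in>{u\<in>U. t \<in> S u \<and> h u \<le> 2 * g t}. V u powr (r / p - 1) * h u powr (r - 1)) * (g t * \<nu> t)
        \<le> 2 powr (r - 1) * C0 * N powr (r - p) * g t powr (p - 1) * (g t * \<nu> t)"
        using inner[OF t gt] gS[OF t] by (rule mult_right_mono)
      also have "\<dots> = 2 powr (r - 1) * C0 * N powr (r - p) * (g t powr p * \<nu> t)"
        using gt by (simp add: powr_diff)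
      finally show ?thesis .
    qed simp
  qed simp
  also have "\<dots> = 2 * 2 powr (r - 1) * C0 * (N powr (r - p) * N powr p)"
    by (simp add: Np sum_distrib_left mult_ac)
  also have "\<dots> = 2 powr r * C0 * N powr r"
  proof -
    have "N powr (r - p) * N powr p = N powr r" by (simp flip: powr_add)
    moreover have "2 * 2 powr (r - 1) = (2 powr r :: real)" by (simp add: powr_diff)
    ultimately show ?thesis by simp
  qed
  finally show ?thesis by (simp only: Nr)
qed

section \<open>Iteration over the coordinates\<close>

definition coords_in :: "'u set \<Rightarrow> 'n set \<Rightarrow> ('n \<Rightarrow> 'u) \<Rightarrow> ('n \<Rightarrow> 'u) set"
  where "coords_in U A z0 = {z. (\<forall>i\<in>A. z i \<in> U) \<and> (\<forall>i. i \<notin> A \<longrightarrow> z i = z0 i)}"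

lemma finite_coords_in:
  fixes A :: "'n::finite set"
  assumes "finite U" shows "finite (coords_in U A z0)"
proof -
  have "coords_in U A z0 \<subseteq> Pi\<^sub>E UNIV (\<lambda>i. insert (z0 i) U)"
    by (auto simp: coords_in_def PiE_def)
  then show ?thesis using assms by (elim finite_subset) (auto intro: finite_PiE)
qed

text \<open>The new coordinate becomes the inner sum for the one-coordinate inequality, or the outer
  sum for the induction hypothesis. In the second form it is absorbed into the base point; this is
  why frozen coordinates keep a value from \<open>z0\<close> instead of being
  \<open>undefined\<close>.\<close>

lemma sum_coords_in_insert:
  assumes "i \<notin> A"
  shows "(\<Sum>z\<in>coords_in U (insert i A) z0. f z) = (\<Sum>z\<in>coords_in U A z0. \<Sum>u\<in>U. f (z(i := u)))"
    and "(\<Sum>z\<in>coords_in U (insert i A) z0. f z) = (\<Sum>u\<in>U. \<Sum>z\<in>coords_in U A (z0(i := u)). f z)"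
proof -
  have "(\<Sum>z\<in>coords_in U A z0. \<Sum>u\<in>U. f (z(i := u))) = (\<Sum>(z, u)\<in>coords_in U A z0 \<times> U. f (z(i := u)))"
    by (rule sum.cartesian_product)
  also have "\<dots> = (\<Sum>z\<in>coords_in U (insert i A) z0. f z)"
    using assms
    by (intro sum.reindex_bij_witness[where j="\<lambda>(z, u). z(i := u)" and i="\<lambda>z. (z(i := z0 i), z i)"])
       (auto simp: coords_in_def fun_eq_iff)
  finally show "(\<Sum>z\<in>coords_in U (insert i A) z0. f z) = (\<Sum>z\<in>coords_in U A z0. \<Sum>u\<in>U. f (z(i := u)))" by simp
  also have "\<dots> = (\<Sum>u\<in>U. \<Sum>z\<in>coords_in U A z0. f (z(i := u)))" by (rule sum.swap)
  also have "\<dots> = (\<Sum>u\<in>U. \<Sum>z\<in>coords_in U A (z0(i := u)). f z)"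
  proof (rule sum.cong[OF refl])
    fix u assume "u \<in> U"
    show "(\<Sum>z\<in>coords_in U A z0. f (z(i := u))) = (\<Sum>z\<in>coords_in U A (z0(i := u)). f z)"
      using assms
      by (intro sum.reindex_bij_witness[where j="\<lambda>z. z(i := u)" and i="\<lambda>z. z(i := z0 i)"])
         (auto simp: coords_in_def fun_eq_iff)
  qed
  finally show "(\<Sum>z\<in>coords_in U (insert i A) z0. f z) = (\<Sum>u\<in>U. \<Sum>z\<in>coords_in U A (z0(i := u)). f z)" .
qed

text \<open>Each step applies \<open>one\<close> in the new coordinate, moves the sum over
  \<open>B\<close> outside by Minkowski's inequality with exponent \<open>r / p > 1\<close>, and
  uses the induction hypothesis at the moved base point. No product structure of \<open>a\<close> is
  assumed: it is enough that \<open>one\<close> holds with the same \<open>C\<close> for all values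
  of the other coordinates. \<open>U\<close> stands for sides of all levels, \<open>B\<close> for
  those of a single finest level.\<close>

lemma tensor_embedding:
  fixes a :: "('n::finite \<Rightarrow> 'u) \<Rightarrow> real"
  assumes fin: "finite U" "finite B" and p: "0 < p" "p < r" and C: "0 \<le> C"
    and a: "\<And>z. 0 \<le> a z"
    and one: "\<And>i z. (\<Sum>u\<in>U. a (z(i := u)) powr r) \<le> C * (\<Sum>u\<in>B. a (z(i := u)) powr p) powr (r / p)"
  shows "(\<Sum>z\<in>coords_in U A z0. a z powr r)
    \<le> C ^ card A * (\<Sum>z\<in>coords_in B A z0. a z powr p) powr (r / p)"
proof -
  have "finite A" by simp
  then show ?thesis
  proof (induction A arbitrary: z0 rule: finite_induct)
    case empty
    have "coords_in W {} z0 = {z0}" for W :: "'u set" by (auto simp: coords_in_def)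
    then show ?case using p by (simp add: powr_powr)
  next
    case (insert i A)
    define s where "s = r / p"
    have s: "1 < s" using p by (simp add: s_def)
    have "(\<Sum>z\<in>coords_in U (insert i A) z0. a z powr r) = (\<Sum>z\<in>coords_in U A z0. \<Sum>u\<in>U. a (z(i := u)) powr r)"
      by (rule sum_coords_in_insert) fact
    also have "\<dots> \<le> (\<Sum>z\<in>coords_in U A z0. C * (\<Sum>u\<in>B. a (z(i := u)) powr p) powr s)"
      unfolding s_def by (intro sum_mono one)
    also have "\<dots> = C * (\<Sum>z\<in>coords_in U A z0. (\<Sum>u\<in>B. a (z(i := u)) powr p) powr s)"
      by (simp add: sum_distrib_left)
    also have "\<dots> \<le> C * (\<Sum>u\<in>B. (\<Sum>z\<in>coords_in U A z0. (a (z(i := u)) powr p) powr s) powr (1 / s)) powr s"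
      using fin s C by (intro mult_left_mono Minkowski_sum finite_coords_in) auto
    also have "\<dots> = C * (\<Sum>u\<in>B. (\<Sum>z\<in>coords_in U A (z0(i := u)). a z powr r) powr (1 / s)) powr s"
    proof -
      have "(\<Sum>z\<in>coords_in U A z0. (a (z(i := u)) powr p) powr s) = (\<Sum>z\<in>coords_in U A (z0(i := u)). a z powr r)" for u
        using p \<open>i \<notin> A\<close>
        by (intro sum.reindex_bij_witness[where j="\<lambda>z. z(i := u)" and i="\<lambda>z. z(i := z0 i)"])
           (auto simp: coords_in_def fun_eq_iff s_def powr_powr)
      then show ?thesis by simp
    qed
    also have "\<dots> \<le> C * (\<Sum>u\<in>B. (C ^ card A * (\<Sum>z\<in>coords_in B A (z0(i := u)). a z powr p) powr s) powr (1 / s)) powr s"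
      using C s a
      by (intro mult_left_mono powr_mono2 sum_mono insert.IH[folded s_def] sum_nonneg) auto
    also have "\<dots> = C * (\<Sum>u\<in>B. (C ^ card A) powr (1 / s) * (\<Sum>z\<in>coords_in B A (z0(i := u)). a z powr p)) powr s"
      using C s a by (simp add: powr_mult powr_powr sum_nonneg)
    also have "\<dots> = C * C ^ card A * (\<Sum>u\<in>B. \<Sum>z\<in>coords_in B A (z0(i := u)). a z powr p) powr s"
      using C s by (simp add: powr_mult powr_powr sum_nonneg flip: sum_distrib_left)
    also have "\<dots> = C ^ card (insert i A) * (\<Sum>z\<in>coords_in B (insert i A) z0. a z powr p) powr s"
      using insert.hyps by (simp add: sum_coords_in_insert(2)[OF \<open>i \<notin> A\<close>])
    finally show ?case by (simp add: s_def)
  qed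
qed

section \<open>Doubling measures on rectangles\<close>

definition subst_coord :: "'n \<Rightarrow> real^'n \<Rightarrow> real \<Rightarrow> real^'n"
  where "subst_coord i x t = (\<chi> j. if j = i then t else x $ j)"

lemma subst_coord_nth: "subst_coord i x t $ j = (if j = i then t else x $ j)"
  by (simp add: subst_coord_def)

lemma strip_sets [measurable]: "{x::real^'n. \<bar>x $ i - c\<bar> \<le> s} \<in> sets borel"
  by (intro borel_closed closed_Collect_le continuous_intros)

text \<open>Tonelli's theorem with one coordinate singled out, from the description of
  \<open>lborel\<close> as an image of a product measure indexed by \<open>Basis\<close>.
  \<open>P\<close> is the product over the other basis vectors, so the \<open>i\<close>-th
  coordinate of \<open>X x\<close> carries no information; \<open>subst_coord\<close> overwrites
  it.\<close>

lemma nn_integral_lborel_split_coordinate: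
  fixes i :: "'n::finite"
  obtains P :: "(real^'n \<Rightarrow> real) measure" and X :: "(real^'n \<Rightarrow> real) \<Rightarrow> real^'n"
  where "(\<lambda>(x, t). subst_coord i (X x) t) \<in> P \<Otimes>\<^sub>M lborel \<rightarrow>\<^sub>M borel"
    and "\<And>f. f \<in> borel_measurable borel \<Longrightarrow>
      (\<integral>\<^sup>+y. f y \<partial>lborel) = (\<integral>\<^sup>+x. \<integral>\<^sup>+t. f (subst_coord i (X x) t) \<partial>lborel \<partial>P)"
proof -
  define b :: "real^'n" where "b = axis i 1"
  define J :: "(real^'n) set" where "J = Basis - {b}"
  define X :: "(real^'n \<Rightarrow> real) \<Rightarrow> real^'n" where "X x = (\<Sum>c\<in>Basis. x c *\<^sub>R c)" for x
  define P :: "(real^'n \<Rightarrow> real) measure" where "P = Pi\<^sub>M J (\<lambda>_. lborel)"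
  interpret product_sigma_finite "\<lambda>_::real^'n. lborel :: real measure" by standard
  have bB: "b \<in> Basis" by (simp add: b_def)
  have Basis: "Basis = insert b J" "b \<notin> J" "finite J" using bB by (auto simp: J_def)
  have comp: "X y $ j = y (axis j 1)" for y j
    unfolding X_def cart_eq_inner_axis by (subst inner_sum_left_Basis) auto
  have X: "X (x(b := t)) = subst_coord i (X x) t" for x t
  proof (rule vec_eq_iff[THEN iffD2], rule allI)
    fix j show "X (x(b := t)) $ j = subst_coord i (X x) t $ j"
      by (simp only: comp subst_coord_nth b_def fun_upd_apply axis_eq_axis) simp
  qed
  have meas: "(\<lambda>(x, t). X (x(b := t))) \<in> P \<Otimes>\<^sub>M lborel \<rightarrow>\<^sub>M borel"
  proof -
    have "(\<lambda>w. if c = b then snd w else fst w c) \<in> P \<Otimes>\<^sub>M lborel \<rightarrow>\<^sub>M borel" if "c \<in> Basis" for c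
    proof (cases "c = b")
      case False
      then have mc: "(\<lambda>x. x c) \<in> P \<rightarrow>\<^sub>M lborel"
        using that unfolding P_def J_def by (intro measurable_component_singleton) auto
      show ?thesis using False measurable_compose[OF measurable_fst mc] by simp
    qed simp
    then have "(\<lambda>w. \<Sum>c\<in>Basis. (if c = b then snd w else fst w c) *\<^sub>R c) \<in> P \<Otimes>\<^sub>M lborel \<rightarrow>\<^sub>M borel"
      by (intro borel_measurable_sum borel_measurable_scaleR) auto
    then show ?thesis by (simp add: X_def fun_upd_apply case_prod_unfold)
  qed
  have int: "(\<integral>\<^sup>+y. f y \<partial>lborel) = (\<integral>\<^sup>+x. \<integral>\<^sup>+t. f (subst_coord i (X x) t) \<partial>lborel \<partial>P)"
    if [measurable]: "f \<in> borel_measurable borel" for f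
  proof -
    have mX: "X \<in> (\<Pi>\<^sub>M b\<in>Basis. lborel) \<rightarrow>\<^sub>M borel"
      unfolding X_def by (intro borel_measurable_sum borel_measurable_scaleR) auto
    have "(\<integral>\<^sup>+y. f y \<partial>lborel) = (\<integral>\<^sup>+x. f (X x) \<partial>(\<Pi>\<^sub>M b\<in>Basis. lborel))"
      using mX by (subst lborel_eq) (simp add: nn_integral_distr X_def)
    also have "\<dots> = (\<integral>\<^sup>+x. \<integral>\<^sup>+t. f (X (x(b := t))) \<partial>lborel \<partial>P)"
      unfolding Basis(1) P_def
      by (rule product_nn_integral_insert)
        (use Basis mX in \<open>auto intro!: measurable_compose[OF _ that] simp flip: Basis(1)\<close>)
    finally show ?thesis by (simp add: X)
  qed
  show thesis by (rule that[OF meas[unfolded X] int])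
qed

text \<open>The doubling inequality on lines in direction \<open>i\<close>, integrated over the
  position of the line. The set \<open>E\<close> does not depend on the \<open>i\<close>-th
  coordinate, so it only selects which lines take part.\<close>

lemma weight_doubling_in_coordinate:
  fixes \<omega> :: "real^'n \<Rightarrow> real"
  assumes w: "rectangle_doubling_weight \<omega>"
  defines "\<mu> \<equiv> density lebesgue (\<lambda>x. ennreal (\<omega> x))"
  obtains D :: real where "1 \<le> D"
    "\<And>i c r E. 0 < r \<Longrightarrow> E \<in> sets borel \<Longrightarrow> (\<And>x t. subst_coord i x t \<in> E \<longleftrightarrow> x \<in> E) \<Longrightarrow>
      emeasure \<mu> (E \<inter> {x. \<bar>x $ i - c\<bar> \<le> 2 * r}) \<le> ennreal D * emeasure \<mu> (E \<inter> {x. \<bar>x $ i - c\<bar> \<le> r})"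
proof -
  from w obtain \<gamma> where \<gamma>: "\<gamma> > 0"
    and dbl: "\<And>i x' c r. 0 < r \<Longrightarrow>
      (\<integral>\<^sup>+t\<in>{c - 2 * r..c + 2 * r}. ennreal (axis_slice \<omega> i x' t) \<partial>lebesgue)
        \<le> ennreal (2 powr (\<gamma> * real CARD('n))) *
           (\<integral>\<^sup>+t\<in>{c - r..c + r}. ennreal (axis_slice \<omega> i x' t) \<partial>lebesgue)"
    and \<omega>: "\<omega> \<in> borel_measurable lebesgue"
    unfolding rectangle_doubling_weight_def by blast
  define D where "D = 2 powr (\<gamma> * real CARD('n))"
  have D1: "1 \<le> D" unfolding D_def using \<gamma> by (intro ge_one_powr_ge_zero) auto
  have "(\<lambda>x. ennreal (\<omega> x)) \<in> borel_measurable (completion lborel)" using \<omega> by simp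
  \<comment> \<open>Tonelli's theorem needs a Borel density, while the doubling hypothesis concerns
    \<open>\<omega>\<close> itself. The two agree off a Borel null set, and almost every line meets
    that set in a null set.\<close>
  from completion_ex_borel_measurable[OF this] obtain \<omega>'
    where \<omega>'[measurable]: "\<omega>' \<in> borel_measurable borel" and ae: "AE x in lborel. ennreal (\<omega> x) = \<omega>' x"
    by auto
  obtain N where N0: "{x \<in> space lborel. ennreal (\<omega> x) \<noteq> \<omega>' x} \<subseteq> N" "emeasure lborel N = 0" "N \<in> sets lborel"
    using AE_E[OF ae] by blast
  then have N: "N \<in> sets borel" "emeasure lborel N = 0" "\<And>x. x \<notin> N \<Longrightarrow> ennreal (\<omega> x) = \<omega>' x"
    by auto
  have main: "emeasure \<mu> (E \<inter> {x. \<bar>x $ i - c\<bar> \<le> 2 * r}) \<le> ennreal D * emeasure \<mu> (E \<inter> {x. \<bar>x $ i - c\<bar> \<le> r})"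
    if r: "0 < r" and E[measurable]: "E \<in> sets borel" and inv: "\<And>x t. subst_coord i x t \<in> E \<longleftrightarrow> x \<in> E" for i c r E
  proof -
    obtain P X where PX[measurable]: "(\<lambda>(x, t). subst_coord i (X x) t) \<in> P \<Otimes>\<^sub>M lborel \<rightarrow>\<^sub>M borel"
      and split: "\<And>f. f \<in> borel_measurable borel \<Longrightarrow>
        (\<integral>\<^sup>+y. f y \<partial>lborel) = (\<integral>\<^sup>+x. \<integral>\<^sup>+t. f (subst_coord i (X x) t) \<partial>lborel \<partial>(P :: (real^'n \<Rightarrow> real) measure))"
      using nn_integral_lborel_split_coordinate[of i] by blast
    have mPX: "(\<lambda>x. \<integral>\<^sup>+t. f (subst_coord i (X x) t) \<partial>lborel) \<in> borel_measurable P"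
      if "f \<in> borel_measurable borel" for f :: "real^'n \<Rightarrow> ennreal"
    proof -
      have "(\<lambda>(x, t). f (subst_coord i (X x) t)) \<in> borel_measurable (P \<Otimes>\<^sub>M lborel)"
        using measurable_compose[OF PX that] by (simp add: case_prod_unfold)
      then show ?thesis by (rule lborel.borel_measurable_nn_integral)
    qed
    have mPX1: "(\<lambda>t. f (subst_coord i (X x) t)) \<in> borel_measurable lborel"
      if "f \<in> borel_measurable borel" "x \<in> space P" for f :: "real^'n \<Rightarrow> ennreal" and x
      using measurable_compose[OF measurable_compose[OF measurable_Pair1'[OF that(2)] PX] that(1)]
      by simp
    have "(\<integral>\<^sup>+x. \<integral>\<^sup>+t. indicator N (subst_coord i (X x) t) \<partial>lborel \<partial>P) = 0"
      using N by (subst split[symmetric]) auto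
    then have "AE x in P. (\<integral>\<^sup>+t. indicator N (subst_coord i (X x) t) \<partial>lborel) = 0"
      using N mPX[of "indicator N"] by (subst (asm) nn_integral_0_iff_AE) auto
    then have aeP: "AE x in P. AE t in lborel. ennreal (axis_slice \<omega> i (X x) t) = \<omega>' (subst_coord i (X x) t)"
    proof (rule AE_mp[OF _ AE_I2], intro impI)
      fix x assume x: "x \<in> space P" "(\<integral>\<^sup>+t. indicator N (subst_coord i (X x) t) \<partial>lborel) = 0"
      then have "AE t in lborel. indicator N (subst_coord i (X x) t) = (0::ennreal)"
        using N by (subst (asm) nn_integral_0_iff_AE) (auto intro!: mPX1)
      then show "AE t in lborel. ennreal (axis_slice \<omega> i (X x) t) = \<omega>' (subst_coord i (X x) t)"
        by eventually_elim (use N in \<open>auto simp: axis_slice_def subst_coord_def indicator_def split: if_splits\<close>)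
    qed
    define A where "A s = E \<inter> {x. \<bar>x $ i - c\<bar> \<le> s}" for s
    have A[measurable]: "A s \<in> sets borel" for s unfolding A_def by (intro sets.Int E strip_sets)
    define B where "B s x = (\<integral>\<^sup>+t. \<omega>' (subst_coord i (X x) t) * indicator (A s) (subst_coord i (X x) t) \<partial>lborel)" for s x
    have B: "B s \<in> borel_measurable P" for s unfolding B_def by (rule mPX) measurable
    have mu: "emeasure \<mu> (A s) = (\<integral>\<^sup>+x. B s x \<partial>P)" for s
    proof -
      have "emeasure \<mu> (A s) = (\<integral>\<^sup>+x. ennreal (\<omega> x) * indicator (A s) x \<partial>lebesgue)"
        unfolding \<mu>_def using \<omega> A[of s] by (intro emeasure_density) auto
      also have "\<dots> = (\<integral>\<^sup>+x. ennreal (\<omega> x) * indicator (A s) x \<partial>lborel)" by (rule nn_integral_completion)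
      also have "\<dots> = (\<integral>\<^sup>+x. \<omega>' x * indicator (A s) x \<partial>lborel)"
        using ae by (intro nn_integral_cong_AE) auto
      also have "\<dots> = (\<integral>\<^sup>+x. B s x \<partial>P)" unfolding B_def by (rule split) measurable
      finally show ?thesis .
    qed
    have "AE x in P. B (2 * r) x \<le> ennreal D * B r x"
      using aeP
    proof eventually_elim
      case (elim x)
      \<comment> \<open>By invariance of \<open>E\<close>, the slice of \<open>A s\<close> is empty
        or the whole interval around \<open>c\<close>, so the integral over it is one to which the
        hypothesis applies.\<close>
      have Beq: "B s x = indicator E (X x) * (\<integral>\<^sup>+t\<in>{c - s..c + s}. ennreal (axis_slice \<omega> i (X x) t) \<partial>lebesgue)" for s
      proof -
        have "B s x = (\<integral>\<^sup>+t. ennreal (axis_slice \<omega> i (X x) t) * indicator (A s) (subst_coord i (X x) t) \<partial>lborel)"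
          unfolding B_def using elim by (intro nn_integral_cong_AE) auto
        also have "\<dots> = (\<integral>\<^sup>+t. ennreal (axis_slice \<omega> i (X x) t) * indicator (A s) (subst_coord i (X x) t) \<partial>lebesgue)"
          by (simp add: nn_integral_completion)
        also have "\<dots> = (\<integral>\<^sup>+t. indicator E (X x) * (ennreal (axis_slice \<omega> i (X x) t) * indicator {c - s..c + s} t) \<partial>lebesgue)"
          by (intro nn_integral_cong) (auto simp: A_def inv subst_coord_nth indicator_def abs_le_iff)
        also have "\<dots> = indicator E (X x) * (\<integral>\<^sup>+t\<in>{c - s..c + s}. ennreal (axis_slice \<omega> i (X x) t) \<partial>lebesgue)"
          by (auto simp: indicator_def)
        finally show ?thesis .
      qed
      show ?case unfolding Beq using dbl[OF r, where c=c and i=i and x'="X x"]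
        by (auto simp: D_def indicator_def)
    qed
    then have "(\<integral>\<^sup>+x. B (2 * r) x \<partial>P) \<le> (\<integral>\<^sup>+x. ennreal D * B r x \<partial>P)" by (rule nn_integral_mono_AE)
    also have "\<dots> = ennreal D * (\<integral>\<^sup>+x. B r x \<partial>P)" using B by (rule nn_integral_cmult)
    finally show ?thesis by (simp add: mu[symmetric] A_def)
  qed
  show thesis using D1 main by (rule that)
qed

section \<open>Closed rectangles and dyadic cells\<close>

definition closed_rect :: "real^'n \<Rightarrow> real^'n \<Rightarrow> (real^'n) set"
  where "closed_rect x \<delta> = {y. \<forall>i. \<bar>x $ i - y $ i\<bar> \<le> \<delta> $ i}"

lemma closed_rect_eq_cbox: "closed_rect x \<delta> = cbox (x - \<delta>) (x + \<delta>)"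
  by (auto simp: closed_rect_def mem_box_cart abs_le_iff algebra_simps)

lemma bounded_imp_subset_closed_rect:
  assumes "bounded S" obtains b where "S \<subseteq> closed_rect 0 (\<chi> i. b)"
proof -
  from assms obtain b where "\<And>x. x \<in> S \<Longrightarrow> norm x \<le> b" by (auto simp: bounded_iff)
  then have "S \<subseteq> closed_rect 0 (\<chi> i. b)"
    by (auto simp: closed_rect_def intro: order_trans[OF component_le_norm_cart])
  then show thesis by (rule that)
qed

text \<open>A cell is indexed by giving, for each coordinate, the level \<open>k\<close> and the position \<open>m\<close>
  of its dyadic side \<open>[m 2\<^sup>k, (m + 1) 2\<^sup>k)\<close>.\<close>

definition cell :: "('n \<Rightarrow> int \<times> int) \<Rightarrow> (real^'n) set"
  where "cell z = {x. \<forall>i. \<lfloor>x $ i / 2 powi fst (z i)\<rfloor> = snd (z i)}"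

definition cell_centre :: "('n \<Rightarrow> int \<times> int) \<Rightarrow> real^'n"
  where "cell_centre z = (\<chi> i. (real_of_int (snd (z i)) + 1 / 2) * 2 powi fst (z i))"

lemma cell_sets [measurable]: "cell z \<in> sets borel"
proof -
  have "cell z = (\<Inter>i. {x. \<lfloor>x $ i / 2 powi fst (z i)\<rfloor> = snd (z i)})" by (auto simp: cell_def)
  also have "\<dots> \<in> sets borel" by measurable
  finally show ?thesis .
qed

lemma floor_level_iff:
  "\<lfloor>x / 2 powi k\<rfloor> = m \<longleftrightarrow> real_of_int m * 2 powi k \<le> x \<and> x < (real_of_int m + 1) * 2 powi k"
proof -
  have "(0::real) < 2 powi k" by simp
  then show ?thesis by (simp add: floor_eq_iff pos_le_divide_eq pos_divide_less_eq)
qed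

lemma mem_cell_iff:
  "x \<in> cell z \<longleftrightarrow> (\<forall>i. real_of_int (snd (z i)) * 2 powi fst (z i) \<le> x $ i \<and>
     x $ i < (real_of_int (snd (z i)) + 1) * 2 powi fst (z i))"
  by (simp add: cell_def floor_level_iff)

text \<open>A quarter of the side and not half of it: the closed rectangle of half the side reaches
  the right end points, which a half-open cell leaves out. With a quarter, the ratios to the
  rectangles used later remain powers of 2.\<close>

lemma closed_rect_subset_cell: "closed_rect (cell_centre z) (\<chi> i. 2 powi fst (z i) / 4) \<subseteq> cell z"
proof
  fix x assume x: "x \<in> closed_rect (cell_centre z) (\<chi> i. 2 powi fst (z i) / 4)"
  show "x \<in> cell z" unfolding mem_cell_iff
  proof
    fix i
    have "(0::real) < 2 powi fst (z i)" by simp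
    moreover have "\<bar>(real_of_int (snd (z i)) + 1 / 2) * 2 powi fst (z i) - x $ i\<bar> \<le> 2 powi fst (z i) / 4"
      using x by (simp add: closed_rect_def cell_centre_def)
    ultimately show "real_of_int (snd (z i)) * 2 powi fst (z i) \<le> x $ i \<and>
     x $ i < (real_of_int (snd (z i)) + 1) * 2 powi fst (z i)"
      unfolding abs_le_iff distrib_right by linarith
  qed
qed

lemma cell_subset_closed_rect: "cell z \<subseteq> closed_rect (cell_centre z) (\<chi> i. 2 powi fst (z i) / 2)"
proof
  fix x assume x: "x \<in> cell z"
  show "x \<in> closed_rect (cell_centre z) (\<chi> i. 2 powi fst (z i) / 2)"
    unfolding closed_rect_def mem_Collect_eq
  proof
    fix i
    have "real_of_int (snd (z i)) * 2 powi fst (z i) \<le> x $ i \<and>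
     x $ i < (real_of_int (snd (z i)) + 1) * 2 powi fst (z i)" using x by (simp add: mem_cell_iff)
    then have "\<bar>(real_of_int (snd (z i)) + 1 / 2) * 2 powi fst (z i) - x $ i\<bar> \<le> 2 powi fst (z i) / 2"
      unfolding abs_le_iff distrib_right by linarith
    then show "\<bar>cell_centre z $ i - x $ i\<bar> \<le> (\<chi> i. 2 powi fst (z i) / 2) $ i"
      by (simp add: cell_centre_def)
  qed
qed

lemma finite_children: "finite {t::int. t div 2 ^ j = m}"
proof (rule finite_subset)
  show "{t::int. t div 2 ^ j = m} \<subseteq> {m * 2 ^ j..(m + 1) * 2 ^ j}"
  proof safe
    fix t :: int
    have "t = t div 2 ^ j * 2 ^ j + t mod 2 ^ j" by (rule div_mult_mod_eq[symmetric])
    moreover have "0 \<le> t mod 2 ^ j" "t mod 2 ^ j < 2 ^ j" by auto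
    ultimately have "t div 2 ^ j * 2 ^ j \<le> t" "t \<le> t div 2 ^ j * 2 ^ j + 2 ^ j" by linarith+
    then show "t \<in> {t div 2 ^ j * 2 ^ j..(t div 2 ^ j + 1) * 2 ^ j}"
      by (simp add: distrib_right)
  qed
qed simp

text \<open>The interval at position \<open>t\<close> has its ancestor \<open>j\<close> levels up at
  position \<open>t div 2 ^ j\<close>. Integer division rounds down, so this is correct for negative
  positions too.\<close>

lemma cell_level_up:
  "x \<in> cell (z(i := (k + int j, m))) \<longleftrightarrow> (\<exists>t. t div 2 ^ j = m \<and> x \<in> cell (z(i := (k, t))))"
proof -
  have "\<lfloor>x $ i / 2 powi (k + int j)\<rfloor> = \<lfloor>x $ i / 2 powi k\<rfloor> div 2 ^ j"
  proof -
    have "x $ i / 2 powi (k + int j) = x $ i / 2 powi k / real_of_int (2 ^ j)"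
      by (simp add: power_int_add)
    then show ?thesis by (simp only: floor_divide_real_eq_div zero_le_power zero_le_numeral)
  qed
  then show ?thesis by (auto simp: cell_def)
qed

lemma cell_disjoint: "z \<noteq> z' \<Longrightarrow> fst \<circ> z = fst \<circ> z' \<Longrightarrow> cell z \<inter> cell z' = {}"
proof (rule ccontr)
  assume *: "z \<noteq> z'" "fst \<circ> z = fst \<circ> z'" "cell z \<inter> cell z' \<noteq> {}"
  then obtain x where x: "x \<in> cell z" "x \<in> cell z'" by auto
  have "z i = z' i" for i
    using x fun_cong[OF *(2), of i] by (simp add: cell_def prod_eq_iff) metis
  with * show False by auto
qed

text \<open>All that the estimates use of the measure, free of densities and slices. Doubling for
  every Borel \<open>E\<close> independent of the \<open>i\<close>-th coordinate is what later
  allows the sides in the other coordinates to be fixed arbitrarily.\<close>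

locale rect_doubling_measure =
  fixes \<mu> :: "(real^'n) measure" and D :: real
  assumes sets_mu: "sets \<mu> = sets lebesgue"
    and D1: "1 \<le> D"
    and finite_closed_rect: "\<And>x \<delta>. emeasure \<mu> (closed_rect x \<delta>) < \<infinity>"
    and doubling: "\<And>i c r E. 0 < r \<Longrightarrow> E \<in> sets borel \<Longrightarrow> (\<And>x t. subst_coord i x t \<in> E \<longleftrightarrow> x \<in> E) \<Longrightarrow>
      emeasure \<mu> (E \<inter> {x. \<bar>x $ i - c\<bar> \<le> 2 * r}) \<le> ennreal D * emeasure \<mu> (E \<inter> {x. \<bar>x $ i - c\<bar> \<le> r})"
    and null_hyperplane: "\<And>i c. {x. x $ i = c} \<in> null_sets \<mu>"
    and nonzero: "emeasure \<mu> UNIV \<noteq> 0"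
begin

lemma space_mu [simp]: "space \<mu> = UNIV"
  using sets_eq_imp_space_eq[OF sets_mu] by simp

lemma borel_sets_mu: "S \<in> sets borel \<Longrightarrow> S \<in> sets \<mu>"
  by (simp add: sets_mu)

lemma cell_sets_mu [measurable, simp]: "cell z \<in> sets \<mu>"
  by (simp add: borel_sets_mu)

lemma closed_rect_sets_mu [measurable, simp]: "closed_rect x \<delta> \<in> sets \<mu>"
  by (simp add: borel_sets_mu closed_rect_eq_cbox)

lemma borel_measurable_mu: "f \<in> borel \<rightarrow>\<^sub>M M \<Longrightarrow> f \<in> \<mu> \<rightarrow>\<^sub>M M"
  using borel_sets_mu by (auto simp: measurable_def)

lemma bounded_finite: "bounded S \<Longrightarrow> emeasure \<mu> S < \<infinity>"
  by (elim bounded_imp_subset_closed_rect)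
     (meson closed_rect_sets_mu emeasure_mono finite_closed_rect le_less_trans)

lemma emeasure_eq: "bounded S \<Longrightarrow> emeasure \<mu> S = ennreal (measure \<mu> S)"
  using bounded_finite[of S] by (intro emeasure_eq_ennreal_measure) auto

lemma bounded_closed_rect: "bounded (closed_rect x \<delta>)"
  by (simp add: closed_rect_eq_cbox)

lemma bounded_cell: "bounded (cell z)"
  using cell_subset_closed_rect bounded_closed_rect bounded_subset by blast

lemma measure_mono: "A \<subseteq> B \<Longrightarrow> B \<in> sets \<mu> \<Longrightarrow> bounded B \<Longrightarrow> measure \<mu> A \<le> measure \<mu> B"
  by (metis emeasure_mono emeasure_eq bounded_subset measure_nonneg ennreal_le_iff)

lemma sigma_finite: "sigma_finite_measure \<mu>"
proof
  have sub: "x \<in> closed_rect 0 (\<chi> i. real n)" if "norm x \<le> real n" for x :: "real^'n" and n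
    using that by (auto simp: closed_rect_def intro: order_trans[OF component_le_norm_cart])
  have "\<exists>n::nat. x \<in> closed_rect 0 (\<chi> i. real n)" for x :: "real^'n"
    using real_arch_simple[of "norm x"] by (auto intro: sub)
  then have "(\<Union>n::nat. closed_rect 0 (\<chi> i. real n)) = (UNIV :: (real^'n) set)"
    by auto
  then show "\<exists>A. countable A \<and> A \<subseteq> sets \<mu> \<and> \<Union> A = space \<mu> \<and> (\<forall>a\<in>A. emeasure \<mu> a \<noteq> \<infinity>)"
    using finite_closed_rect
    by (intro exI[of _ "range (\<lambda>n::nat. closed_rect 0 (\<chi> i. real n))"]) (auto simp: less_top[symmetric])
qed

lemma doubling_iterated:
  assumes "0 < r" "E \<in> sets borel" "\<And>x t. subst_coord i x t \<in> E \<longleftrightarrow> x \<in> E"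
  shows "emeasure \<mu> (E \<inter> {x. \<bar>x $ i - c\<bar> \<le> 2 ^ j * r}) \<le> ennreal (D ^ j) * emeasure \<mu> (E \<inter> {x. \<bar>x $ i - c\<bar> \<le> r})"
proof (induction j)
  case (Suc j)
  have "emeasure \<mu> (E \<inter> {x. \<bar>x $ i - c\<bar> \<le> 2 * (2 ^ j * r)}) \<le> ennreal D * emeasure \<mu> (E \<inter> {x. \<bar>x $ i - c\<bar> \<le> 2 ^ j * r})"
    using assms by (intro doubling) auto
  also have "\<dots> \<le> ennreal D * (ennreal (D ^ j) * emeasure \<mu> (E \<inter> {x. \<bar>x $ i - c\<bar> \<le> r}))"
    by (intro mult_left_mono Suc) auto
  finally show ?case using D1 by (simp add: mult_ac ennreal_mult)
qed simp

text \<open>In \<open>\<Delta> A\<close> the coordinates in \<open>A\<close> are already enlarged;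
  enlarging one more costs the factor \<open>D ^ j\<close>.\<close>

lemma closed_rect_doubling:
  assumes "\<And>i. 0 < \<delta> $ i"
  shows "measure \<mu> (closed_rect x (2 ^ j *\<^sub>R \<delta>)) \<le> D ^ (j * CARD('n)) * measure \<mu> (closed_rect x \<delta>)"
proof -
  define \<Delta> where "\<Delta> A = (\<chi> i. if i \<in> A then 2 ^ j * \<delta> $ i else \<delta> $ i)" for A
  have "measure \<mu> (closed_rect x (\<Delta> A)) \<le> D ^ (j * card A) * measure \<mu> (closed_rect x \<delta>)" for A :: "'n set"
  proof -
    have "finite A" by simp
    then show ?thesis
    proof (induction A rule: finite_induct)
      case empty
      have "\<Delta> {} = \<delta>" by (simp add: \<Delta>_def vec_eq_iff)
      then show ?case by simp
    next
      case (insert i A)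
      define E where "E = {y. \<forall>k. k \<noteq> i \<longrightarrow> \<bar>x $ k - y $ k\<bar> \<le> \<Delta> A $ k}"
      have E: "E \<in> sets borel"
      proof -
        have "E = (\<Inter>k\<in>-{i}. {y. \<bar>x $ k - y $ k\<bar> \<le> \<Delta> A $ k})" by (auto simp: E_def)
        moreover have "closed (\<Inter>k\<in>-{i}. {y. \<bar>x $ k - y $ k\<bar> \<le> \<Delta> A $ k})"
          by (intro closed_INT ballI closed_Collect_le continuous_intros)
        ultimately show ?thesis by simp
      qed
      have 1: "closed_rect x (\<Delta> (insert i A)) = E \<inter> {y. \<bar>y $ i - x $ i\<bar> \<le> 2 ^ j * \<delta> $ i}"
        using insert.hyps by (auto simp: closed_rect_def E_def \<Delta>_def abs_minus_commute split: if_splits)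
      have 2: "closed_rect x (\<Delta> A) = E \<inter> {y. \<bar>y $ i - x $ i\<bar> \<le> \<delta> $ i}"
      proof -
        have "\<Delta> A $ i = \<delta> $ i" using insert.hyps by (simp add: \<Delta>_def)
        moreover have "(\<forall>k. \<bar>x $ k - y $ k\<bar> \<le> \<Delta> A $ k) \<longleftrightarrow>
            (\<forall>k. k \<noteq> i \<longrightarrow> \<bar>x $ k - y $ k\<bar> \<le> \<Delta> A $ k) \<and> \<bar>x $ i - y $ i\<bar> \<le> \<Delta> A $ i" for y
          by metis
        ultimately show ?thesis
          by (simp only: closed_rect_def E_def set_eq_iff mem_Collect_eq Int_iff abs_minus_commute[of "_ $ i" "x $ i"]) simp
      qed
      have "emeasure \<mu> (closed_rect x (\<Delta> (insert i A))) \<le> ennreal (D ^ j) * emeasure \<mu> (closed_rect x (\<Delta> A))"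
        unfolding 1 2 using assms E by (intro doubling_iterated) (auto simp: E_def subst_coord_nth)
      then have "measure \<mu> (closed_rect x (\<Delta> (insert i A))) \<le> D ^ j * measure \<mu> (closed_rect x (\<Delta> A))"
        using D1 by (simp add: emeasure_eq bounded_closed_rect flip: ennreal_mult)
      also have "\<dots> \<le> D ^ j * (D ^ (j * card A) * measure \<mu> (closed_rect x \<delta>))"
        using D1 by (intro mult_left_mono insert.IH) auto
      finally show ?case using insert.hyps by (simp add: power_add mult_ac)
    qed
  qed
  from this[of UNIV] show ?thesis by (simp add: \<Delta>_def scaleR_vec_def)
qed

text \<open>If one rectangle were null, all its dilates would be null by doubling, and they exhaust
  the space.\<close>

lemma closed_rect_pos:
  assumes "\<And>i. 0 < \<delta> $ i"
  shows "0 < measure \<mu> (closed_rect x \<delta>)"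
proof (rule ccontr)
  assume "\<not> 0 < measure \<mu> (closed_rect x \<delta>)"
  then have 0: "measure \<mu> (closed_rect x \<delta>) = 0" using measure_nonneg[of \<mu>] by (simp add: not_less order_antisym)
  have "closed_rect x (2 ^ j *\<^sub>R \<delta>) \<in> null_sets \<mu>" for j
    using closed_rect_doubling[OF assms, of x j] 0
    by (auto simp: emeasure_eq bounded_closed_rect measure_le_0_iff intro!: null_setsI)
  then have "(\<Union>j. closed_rect x (2 ^ j *\<^sub>R \<delta>)) \<in> null_sets \<mu>" by (rule null_sets_UN)
  moreover have "(\<Union>j. closed_rect x (2 ^ j *\<^sub>R \<delta>)) = UNIV"
  proof -
    have "\<exists>j. y \<in> closed_rect x (2 ^ j *\<^sub>R \<delta>)" for y
    proof -
      define b where "b = Max (range (\<lambda>i. \<bar>x $ i - y $ i\<bar> / \<delta> $ i))"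
      obtain j where "b < 2 ^ j" using real_arch_pow[of 2 b] by auto
      moreover have "\<bar>x $ i - y $ i\<bar> / \<delta> $ i \<le> b" for i unfolding b_def by (intro Max_ge) auto
      ultimately have q: "\<bar>x $ i - y $ i\<bar> / \<delta> $ i \<le> 2 ^ j" for i by (meson le_less_trans less_imp_le)
      have "\<bar>x $ i - y $ i\<bar> \<le> 2 ^ j * \<delta> $ i" for i using q[of i] assms[of i] by (simp add: pos_divide_le_eq)
      then show ?thesis by (auto simp: closed_rect_def)
    qed
    then show ?thesis by auto
  qed
  ultimately show False using nonzero by (auto simp: null_sets_def)
qed

text \<open>The pattern of the later comparisons that enlarge all coordinates at once: a rectangle
  inside \<open>A\<close> has a concentric dilate that covers \<open>B\<close>.\<close>

lemma measure_le_of_closed_rect: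
  assumes "closed_rect x \<delta> \<subseteq> A" "B \<subseteq> closed_rect x (2 ^ j *\<^sub>R \<delta>)" "\<And>i. 0 < \<delta> $ i"
    "A \<in> sets \<mu>" "bounded A"
  shows "measure \<mu> B \<le> D ^ (j * CARD('n)) * measure \<mu> A"
proof -
  have "measure \<mu> B \<le> measure \<mu> (closed_rect x (2 ^ j *\<^sub>R \<delta>))"
    using assms by (intro measure_mono bounded_closed_rect) auto
  also have "\<dots> \<le> D ^ (j * CARD('n)) * measure \<mu> (closed_rect x \<delta>)" by (rule closed_rect_doubling) fact
  also have "\<dots> \<le> D ^ (j * CARD('n)) * measure \<mu> A"
    using assms D1 by (intro mult_left_mono measure_mono) auto
  finally show ?thesis .
qed

lemma cell_pos: "0 < measure \<mu> (cell z)"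
proof -
  have "0 < measure \<mu> (closed_rect (cell_centre z) (\<chi> i. 2 powi fst (z i) / 4))"
    by (rule closed_rect_pos) simp
  also have "\<dots> \<le> measure \<mu> (cell z)"
    by (intro measure_mono closed_rect_subset_cell bounded_cell) simp
  finally show ?thesis .
qed

text \<open>The strip around the centre of the side at \<open>m'\<close>, with half-width a quarter
  of the side, lies in that cell. The far end of an adjacent side is one and a half sides from the
  centre, and three doublings reach two sides. Only the coordinate \<open>i\<close> is enlarged,
  hence \<open>D ^ 3\<close> without the dimension.\<close>

lemma cell_neighbour:
  assumes "\<bar>m - m'\<bar> \<le> 1"
  shows "measure \<mu> (cell (z(i := (k, m)))) \<le> D ^ 3 * measure \<mu> (cell (z(i := (k, m'))))"
proof -
  define h where "h = (2::real) powi k"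
  have h: "h > 0" by (simp add: h_def)
  define c where "c = (real_of_int m' + 1 / 2) * h"
  define E where "E = {x::real^'n. \<forall>l\<in>-{i}. \<lfloor>x $ l / 2 powi fst (z l)\<rfloor> = snd (z l)}"
  have E: "E \<in> sets borel"
  proof -
    have "E = (\<Inter>l\<in>UNIV. {x::real^'n. l \<noteq> i \<longrightarrow> \<lfloor>x $ l / 2 powi fst (z l)\<rfloor> = snd (z l)})" by (auto simp: E_def)
    also have "\<dots> \<in> sets borel" by measurable
    finally show ?thesis .
  qed
  have cellE: "cell (z(i := (k, l))) = E \<inter> {x. real_of_int l * h \<le> x $ i \<and> x $ i < (real_of_int l + 1) * h}" for l
    by (auto simp: cell_def E_def h_def floor_level_iff[symmetric])
  have m: "real_of_int m \<le> real_of_int m' + 1" "real_of_int m' - 1 \<le> real_of_int m" using assms by linarith+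
  have mh: "real_of_int m * h \<le> (real_of_int m' + 1) * h" "(real_of_int m' - 1) * h \<le> real_of_int m * h"
    using m h by (auto intro: mult_right_mono)
  have sub1: "cell (z(i := (k, m))) \<subseteq> E \<inter> {x. \<bar>x $ i - c\<bar> \<le> 2 ^ 3 * (h / 4)}"
    unfolding cellE
  proof safe
    fix x :: "real^'n" assume "real_of_int m * h \<le> x $ i" "x $ i < (real_of_int m + 1) * h"
    then show "\<bar>x $ i - c\<bar> \<le> 2 ^ 3 * (h / 4)"
      using mh h unfolding c_def abs_le_iff distrib_right left_diff_distrib by simp
  qed
  have sub2: "E \<inter> {x. \<bar>x $ i - c\<bar> \<le> h / 4} \<subseteq> cell (z(i := (k, m')))"
    unfolding cellE
  proof safe
    fix x :: "real^'n" assume x: "\<bar>x $ i - c\<bar> \<le> h / 4"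
    show "real_of_int m' * h \<le> x $ i" "x $ i < (real_of_int m' + 1) * h"
      using x h unfolding c_def abs_le_iff distrib_right by linarith+
  qed
  have ms: "E \<inter> {x. \<bar>x $ i - c\<bar> \<le> s} \<in> sets \<mu>" for s using E by (intro borel_sets_mu sets.Int strip_sets)
  have "emeasure \<mu> (cell (z(i := (k, m)))) \<le> emeasure \<mu> (E \<inter> {x. \<bar>x $ i - c\<bar> \<le> 2 ^ 3 * (h / 4)})"
    using sub1 ms by (rule emeasure_mono)
  also have "\<dots> \<le> ennreal (D ^ 3) * emeasure \<mu> (E \<inter> {x. \<bar>x $ i - c\<bar> \<le> h / 4})"
    using h E by (intro doubling_iterated) (auto simp: E_def subst_coord_nth)
  also have "\<dots> \<le> ennreal (D ^ 3) * emeasure \<mu> (cell (z(i := (k, m'))))"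
    using sub2 by (intro mult_left_mono emeasure_mono) auto
  finally show ?thesis using D1 by (simp add: emeasure_eq bounded_cell flip: ennreal_mult)
qed

lemma measure_cell_level_up:
  "measure \<mu> (cell (z(i := (k + int j, m)))) = (\<Sum>t | t div 2 ^ j = m. measure \<mu> (cell (z(i := (k, t)))))"
proof -
  have "cell (z(i := (k + int j, m))) = (\<Union>t\<in>{t. t div 2 ^ j = m}. cell (z(i := (k, t))))"
    by (auto simp: cell_level_up)
  moreover have "disjoint_family_on (\<lambda>t. cell (z(i := (k, t)))) {t. t div 2 ^ j = m}"
    unfolding disjoint_family_on_def
    by (intro ballI impI cell_disjoint) (auto simp: fun_eq_iff)
  ultimately show ?thesis
    using finite_children bounded_finite[OF bounded_cell]
    by (simp add: measure_finite_Union less_top[symmetric] image_subset_iff)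
qed

text \<open>The parent is the disjoint union of the cell and its sibling at \<open>m'\<close>, and
  the sibling, being adjacent, carries at least the fraction \<open>1 / D ^ 3\<close> of the mass of
  the cell. This growth makes sums over levels geometric.\<close>

lemma cell_reverse_doubling:
  "(1 + 1 / D ^ 3) * measure \<mu> (cell (z(i := (k, m)))) \<le> measure \<mu> (cell (z(i := (k + 1, m div 2))))"
proof -
  define m' where "m' = (if even m then m + 1 else m - 1)"
  have m': "m' div 2 = m div 2" "m' \<noteq> m" "\<bar>m - m'\<bar> \<le> 1" by (auto simp: m'_def) presburger+
  have sub: "{t::int. t div 2 ^ 1 = m div 2} = {m, m'}" unfolding m'_def by (auto split: if_splits) presburger+
  have "measure \<mu> (cell (z(i := (k + 1, m div 2)))) = measure \<mu> (cell (z(i := (k, m)))) + measure \<mu> (cell (z(i := (k, m'))))"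
    using measure_cell_level_up[of z i k 1 "m div 2"] m' unfolding sub by simp
  moreover have "measure \<mu> (cell (z(i := (k, m)))) / D ^ 3 \<le> measure \<mu> (cell (z(i := (k, m'))))"
    using cell_neighbour[OF m'(3), of z i k] D1 by (simp add: field_simps)
  ultimately show ?thesis by (simp add: distrib_right)
qed

end

section \<open>The embedding over dyadic cells\<close>

text \<open>The tangent at 1 of a convex function, read off from Young's inequality with second
  factor 1. It replaces Jensen's inequality for cell averages.\<close>

lemma powr_ge_tangent:
  fixes t p :: real
  assumes "0 \<le> t" "1 < p"
  shows "1 + p * (t - 1) \<le> t powr p"
proof -
  define q where "q = p / (p - 1)"
  have q: "q > 1" "1 / p + 1 / q = 1" "p / q = p - 1" using assms by (auto simp: q_def field_simps)
  have "t * 1 \<le> t powr p / p + 1 powr q / q" using assms q by (intro Youngs_inequality) auto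
  then have "p * t \<le> p * (t powr p / p + 1 / q)" using assms by (intro mult_left_mono) auto
  also have "\<dots> = t powr p + (p - 1)" using assms q by (simp add: distrib_left)
  finally show ?thesis by (simp add: algebra_simps)
qed

context rect_doubling_measure
begin

definition cell_integral :: "(real^'n \<Rightarrow> real) \<Rightarrow> ('n \<Rightarrow> int \<times> int) \<Rightarrow> real"
  where "cell_integral g z = (\<integral>x. indicator (cell z) x * g x \<partial>\<mu>)"

text \<open>The cell average of \<open>g\<close>, normalised so that its \<open>p\<close>-th power is at most \<open>\<integral>\<^sub>Q g\<^sup>p d\<mu>\<close>.\<close>

definition cell_coeff :: "real \<Rightarrow> (real^'n \<Rightarrow> real) \<Rightarrow> ('n \<Rightarrow> int \<times> int) \<Rightarrow> real"
  where "cell_coeff p g z = measure \<mu> (cell z) powr (1 / p - 1) * cell_integral g z"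

lemma integrable_indicator_bounded:
  "S \<in> sets \<mu> \<Longrightarrow> bounded S \<Longrightarrow> integrable \<mu> (indicator S :: _ \<Rightarrow> real)"
  using bounded_finite[of S] by (intro integrable_real_indicator) auto

lemma Lp_integrable_on_bounded:
  fixes g :: "real^'n \<Rightarrow> real"
  assumes g: "g \<in> borel_measurable \<mu>" "\<And>x. 0 \<le> g x" "integrable \<mu> (\<lambda>x. g x powr p)" and p: "1 \<le> p"
    and S: "S \<in> sets \<mu>" "bounded S"
  shows "integrable \<mu> (\<lambda>x. indicator S x * g x)"
proof (rule Bochner_Integration.integrable_bound)
  show "integrable \<mu> (\<lambda>x. indicator S x + g x powr p)"
    using g S by (intro Bochner_Integration.integrable_add integrable_indicator_bounded)
  show "(\<lambda>x. indicator S x * g x) \<in> borel_measurable \<mu>" using g S by measurable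
  have "g x \<le> 1 + g x powr p" for x
  proof (cases "g x \<le> 1")
    case True
    have "0 \<le> g x powr p" by simp
    with True show ?thesis by linarith
  next
    case False
    then have "g x powr 1 \<le> g x powr p" using p by (intro powr_mono) auto
    with False show ?thesis by simp
  qed
  then show "AE x in \<mu>. norm (indicator S x * g x) \<le> norm (indicator S x + g x powr p)"
    using g by (auto simp: indicator_def)
qed

lemma integrable_indicator_mult:
  fixes f :: "real^'n \<Rightarrow> real"
  shows "integrable \<mu> f \<Longrightarrow> S \<in> sets \<mu> \<Longrightarrow> integrable \<mu> (\<lambda>x. indicator S x * f x)"
  using integrable_mult_indicator[of S \<mu> f] by simp

text \<open>Jensen's inequality: the tangent to the \<open>p\<close>-th power at the average
  \<open>A\<close> lies below it, and its integral over the cell is exactly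
  \<open>m * A powr p\<close>.\<close>

lemma cell_coeff_powr_le:
  fixes g :: "real^'n \<Rightarrow> real"
  assumes g: "g \<in> borel_measurable \<mu>" "\<And>x. 0 \<le> g x" "integrable \<mu> (\<lambda>x. g x powr p)" and p: "1 < p"
  shows "cell_coeff p g z powr p \<le> (\<integral>x. indicator (cell z) x * g x powr p \<partial>\<mu>)"
proof -
  define m where "m = measure \<mu> (cell z)"
  have m: "m > 0" by (simp add: m_def cell_pos)
  define I where "I = cell_integral g z"
  have I0: "0 \<le> I" unfolding I_def cell_integral_def using g by (intro integral_nonneg_AE) auto
  have int: "integrable \<mu> (\<lambda>x. indicator (cell z) x * g x)"
    using p by (intro Lp_integrable_on_bounded[OF g] bounded_cell) auto
  show ?thesis
  proof (cases "I = 0")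
    case True
    then show ?thesis using g by (auto simp: cell_coeff_def I_def intro!: integral_nonneg_AE)
  next
    case False
    define A where "A = I / m"
    have A: "A > 0" using False I0 m by (simp add: A_def)
    have "m * A powr p = A powr p * (1 - p) * m + A powr p * (p / A) * I"
      using A m by (simp add: A_def field_simps)
    also have "\<dots> = (\<integral>x. A powr p * (1 - p) * indicator (cell z) x + A powr p * (p / A) * (indicator (cell z) x * g x) \<partial>\<mu>)"
      using int integrable_indicator_bounded[of "cell z"] bounded_cell[of z]
      by (subst Bochner_Integration.integral_add) (auto simp: m_def I_def cell_integral_def)
    also have "\<dots> \<le> (\<integral>x. indicator (cell z) x * g x powr p \<partial>\<mu>)"
    proof (rule integral_mono)
      fix x
      have "A powr p * (1 + p * (g x / A - 1)) \<le> A powr p * (g x / A) powr p"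
        using g A p by (intro mult_left_mono powr_ge_tangent) auto
      also have "\<dots> = g x powr p" using A g by (simp add: powr_divide)
      finally show "A powr p * (1 - p) * indicator (cell z) x + A powr p * (p / A) * (indicator (cell z) x * g x)
        \<le> indicator (cell z) x * g x powr p"
        by (auto simp: indicator_def algebra_simps)
    qed (use int g integrable_indicator_bounded[of "cell z"] bounded_cell[of z] integrable_indicator_mult in auto)
    also have "m * A powr p = cell_coeff p g z powr p"
    proof -
      have "cell_coeff p g z = m powr (1 / p) * A"
        using m by (simp add: cell_coeff_def m_def[symmetric] I_def[symmetric] A_def powr_diff)
      then show ?thesis using m A p by (simp add: powr_mult powr_powr)
    qed
    finally show ?thesis .
  qed
qed

lemma sum_indicator_cells:
  assumes "finite Z" "\<And>z z'. z \<in> Z \<Longrightarrow> z' \<in> Z \<Longrightarrow> fst \<circ> z = fst \<circ> z'"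
  shows "(\<Sum>z\<in>Z. indicator (cell z) x) = (indicator (\<Union>z\<in>Z. cell z) x :: real)"
proof -
  have "disjoint_family_on cell Z"
    using assms(2) by (auto simp: disjoint_family_on_def intro!: cell_disjoint)
  then show ?thesis using assms(1) by (intro indicator_UN_disjoint[symmetric])
qed

lemma cell_integral_level_up:
  assumes "\<And>z. integrable \<mu> (\<lambda>x. indicator (cell z) x * g x)"
  shows "cell_integral g (z(i := (k + int j, m))) = (\<Sum>t | t div 2 ^ j = m. cell_integral g (z(i := (k, t))))"
proof -
  define \<phi> where "\<phi> t = z(i := (k, t))" for t
  have inj: "inj_on \<phi> A" for A by (auto simp: inj_on_def \<phi>_def fun_eq_iff)
  have "(\<Union>w\<in>\<phi> ` {t. t div 2 ^ j = m}. cell w) = cell (z(i := (k + int j, m)))"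
    by (auto simp: cell_level_up \<phi>_def)
  then have "indicator (cell (z(i := (k + int j, m)))) x = (\<Sum>w\<in>\<phi> ` {t. t div 2 ^ j = m}. indicator (cell w) x :: real)" for x
    by (subst sum_indicator_cells) (auto simp: finite_children fun_eq_iff \<phi>_def)
  then have "indicator (cell (z(i := (k + int j, m)))) x = (\<Sum>t | t div 2 ^ j = m. indicator (cell (\<phi> t)) x :: real)" for x
    by (simp add: sum.reindex[OF inj])
  then show ?thesis
    unfolding cell_integral_def using assms by (simp add: sum_distrib_right \<phi>_def)
qed

text \<open>The sum over sides of all levels is reduced, coordinate by coordinate, to one over cells
  with every side at the finest level \<open>k0\<close>. These are disjoint, so Jensen's inequality
  on each bounds their total by the integral of \<open>g powr p\<close>. The constant is independent
  of \<open>k0\<close> and depends on the measure only through \<open>D\<close>.\<close>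

theorem cell_embedding:
  assumes p: "1 < p" and r: "p < r"
  obtains C where "0 \<le> C"
    "\<And>g Z. g \<in> borel_measurable \<mu> \<Longrightarrow> (\<And>x. 0 \<le> g x) \<Longrightarrow> integrable \<mu> (\<lambda>x. g x powr p) \<Longrightarrow> finite Z \<Longrightarrow>
      (\<Sum>z\<in>Z. cell_coeff p g z powr r) \<le> C * (\<integral>x. g x powr p \<partial>\<mu>) powr (r / p)"
proof -
  \<comment> \<open>The smaller of the two decay rates that occur in the one-coordinate
    estimate.\<close>
  define \<kappa> where "\<kappa> = min (r / p - 1) (1 - 1 / p)"
  have \<kappa>: "0 < \<kappa>" "\<kappa> \<le> r / p - 1" "\<kappa> \<le> 1 - 1 / p" using p r by (auto simp: \<kappa>_def)
  define \<rho> where "\<rho> = 1 + 1 / D ^ 3"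
  have \<rho>: "\<rho> > 1" using D1 by (simp add: \<rho>_def)
  define R where "R = \<rho> powr \<kappa>"
  have R: "R > 1" using \<rho> \<kappa> by (simp add: R_def)
  define C0 where "C0 = 4 * R / (R - 1)"
  define C1 where "C1 = 2 powr r * C0"
  have C0: "0 \<le> C0" using R by (simp add: C0_def)
  then have C1: "0 \<le> C1" by (simp add: C1_def)
  have main: "(\<Sum>z\<in>Z. cell_coeff p g z powr r) \<le> C1 ^ CARD('n) * (\<integral>x. g x powr p \<partial>\<mu>) powr (r / p)"
    if g: "g \<in> borel_measurable \<mu>" "\<And>x. 0 \<le> g x" "integrable \<mu> (\<lambda>x. g x powr p)" and Z: "finite Z" for g Z
  proof -
    \<comment> \<open>The sides of all cells of \<open>Z\<close> in all coordinates. Enlarging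
      \<open>Z\<close> to every cell with sides in \<open>U\<close> gives a product, as
      tensorisation requires.\<close>
    define U where "U = (\<Union>z\<in>Z. range z)"
    have U: "finite U" using Z by (auto simp: U_def)
    \<comment> \<open>The inserted 0 provides a value when \<open>U\<close> is empty.\<close>
    define k0 where "k0 = Min (insert 0 (fst ` U))"
    have k0: "k0 \<le> fst u" if "u \<in> U" for u unfolding k0_def using that U by (intro Min_le) auto
    define S where "S u = {t::int. t div 2 ^ nat (fst u - k0) = snd u}" for u :: "int \<times> int"
    have finS: "finite (S u)" for u by (simp add: S_def finite_children)
    define T where "T = (\<Union>u\<in>U. S u)"
    have T: "finite T" using U finS by (auto simp: T_def)
    define B where "B = Pair k0 ` T"
    have B: "finite B" using T by (simp add: B_def)
    have int: "integrable \<mu> (\<lambda>x. indicator (cell z) x * g x)" for z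
      using p by (intro Lp_integrable_on_bounded[OF g] bounded_cell) auto
    have F0: "0 \<le> cell_integral g z" for z
      unfolding cell_integral_def using g by (intro integral_nonneg_AE) auto
    have a0: "0 \<le> cell_coeff p g z" for z using F0 by (simp add: cell_coeff_def)
    have ueq: "(k0 + int (nat (fst u - k0)), snd u) = u" if "u \<in> U" for u
      using k0[OF that] by (simp add: prod_eq_iff)
    have one: "(\<Sum>u\<in>U. cell_coeff p g (z(i := u)) powr r) \<le> C1 * (\<Sum>u\<in>B. cell_coeff p g (z(i := u)) powr p) powr (r / p)" for i z
    proof -
      define \<nu> where "\<nu> t = measure \<mu> (cell (z(i := (k0, t))))" for t
      \<comment> \<open>The averages over the cells at level \<open>k0\<close> form a step function
        with weights \<open>\<nu>\<close>. Its sums reproduce the integrals of \<open>g\<close> over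
        the coarser cells exactly, so the discretisation loses nothing.\<close>
      define h where "h t = cell_integral g (z(i := (k0, t))) / \<nu> t" for t
      define V where "V u = measure \<mu> (cell (z(i := u)))" for u
      have \<nu>0: "0 < \<nu> t" for t by (simp add: \<nu>_def cell_pos)
      have h0: "0 \<le> h t" for t using F0 \<nu>0[of t] by (simp add: h_def)
      have V: "V u = (\<Sum>t\<in>S u. \<nu> t)" if "u \<in> U" for u
        using measure_cell_level_up[of z i k0 "nat (fst u - k0)" "snd u"]
        unfolding ueq[OF that] V_def \<nu>_def S_def .
      have F: "cell_integral g (z(i := u)) = (\<Sum>t\<in>S u. h t * \<nu> t)" if "u \<in> U" for u
      proof -
        have "h t * \<nu> t = cell_integral g (z(i := (k0, t)))" for t using \<nu>0[of t] by (simp add: h_def)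
        then show ?thesis
          using cell_integral_level_up[OF int, of z i k0 "nat (fst u - k0)" "snd u"]
          unfolding ueq[OF that] S_def by simp
      qed
      have geo: "(\<Sum>u\<in>{u\<in>U. t \<in> S u}. min ((V u / c) powr \<kappa>) (1 / (V u / c) powr \<kappa>)) \<le> C0"
        if "0 < c" for t and c :: real
      proof -
        \<comment> \<open>The intervals containing the finest interval \<open>t\<close> form a chain
          with one member per level. \<open>x\<close> follows the whole chain, including levels
          absent from \<open>U\<close>, because the growth estimate compares consecutive levels;
          \<open>J\<close> then embeds the sides at hand into it.\<close>
        define x where "x j = (V (k0 + int j, t div 2 ^ j) / c) powr \<kappa>" for j
        have V0: "0 < V u" for u by (simp add: V_def cell_pos)
        have x0: "0 < x j" for j using V0[of "(k0 + int j, t div 2 ^ j)"] that by (simp add: x_def)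
        have grow: "R * x j \<le> x (Suc j)" for j
        proof -
          have "t div 2 ^ Suc j = t div 2 ^ j div 2" by (simp only: power_Suc2 zdiv_zmult2_eq zero_le_numeral)
          then have "\<rho> * V (k0 + int j, t div 2 ^ j) \<le> V (k0 + int (Suc j), t div 2 ^ Suc j)"
            using cell_reverse_doubling[of z i "k0 + int j" "t div 2 ^ j"]
            by (simp add: V_def \<rho>_def add_ac)
          then have "\<rho> * (V (k0 + int j, t div 2 ^ j) / c) \<le> V (k0 + int (Suc j), t div 2 ^ Suc j) / c"
            using that by (simp add: divide_right_mono)
          then have "(\<rho> * (V (k0 + int j, t div 2 ^ j) / c)) powr \<kappa> \<le> x (Suc j)"
            unfolding x_def using \<kappa> \<rho> V0[of "(k0 + int j, t div 2 ^ j)"] that by (intro powr_mono2) auto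
          moreover have "(\<rho> * (V (k0 + int j, t div 2 ^ j) / c)) powr \<kappa> = R * x j"
            unfolding x_def R_def by (rule powr_mult)
          ultimately show ?thesis by simp
        qed
        define J where "J u = nat (fst u - k0)" for u :: "int \<times> int"
        have uJ: "u = (k0 + int (J u), t div 2 ^ J u)" if "u \<in> U" "t \<in> S u" for u
          using k0[OF that(1)] that(2) by (simp add: J_def S_def prod_eq_iff)
        have inj: "inj_on J {u\<in>U. t \<in> S u}"
        proof (rule inj_onI)
          fix u v assume uv: "u \<in> {u\<in>U. t \<in> S u}" "v \<in> {u\<in>U. t \<in> S u}" "J u = J v"
          have "u = (k0 + int (J u), t div 2 ^ J u)" using uJ uv by blast
          also have "\<dots> = v" unfolding uv(3) using uJ[of v] uv by simp
          finally show "u = v" .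
        qed
        define n where "n = Suc (Max (insert 0 (J ` U)))"
        have n: "J u < n" if "u \<in> U" for u
          unfolding n_def less_Suc_eq_le using that U by (intro Max_ge) auto
        have "(\<Sum>u\<in>{u\<in>U. t \<in> S u}. min ((V u / c) powr \<kappa>) (1 / (V u / c) powr \<kappa>))
          = (\<Sum>u\<in>{u\<in>U. t \<in> S u}. min (x (J u)) (1 / x (J u)))"
        proof (rule sum.cong[OF refl])
          fix u assume "u \<in> {u\<in>U. t \<in> S u}"
          then have "x (J u) = (V u / c) powr \<kappa>" using uJ[of u] by (simp add: x_def)
          then show "min ((V u / c) powr \<kappa>) (1 / (V u / c) powr \<kappa>) = min (x (J u)) (1 / x (J u))" by simp
        qed
        also have "\<dots> = (\<Sum>j\<in>J ` {u\<in>U. t \<in> S u}. min (x j) (1 / x j))"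
          by (simp add: sum.reindex[OF inj])
        also have "\<dots> \<le> (\<Sum>j<n. min (x j) (1 / x j))"
          using n x0 by (intro sum_mono2) (auto simp: less_imp_le)
        also have "\<dots> \<le> C0" unfolding C0_def using R x0 grow by (rule sum_min_geometric[where x=x])
        finally show ?thesis .
      qed
      have nonempty: "S u \<noteq> {}" for u
      proof -
        have "snd u * 2 ^ nat (fst u - k0) \<in> S u" by (simp add: S_def)
        then show ?thesis by blast
      qed
      have "(\<Sum>u\<in>U. (V u powr (1 / p - 1) * (\<Sum>t\<in>S u. h t * \<nu> t)) powr r)
        \<le> 2 powr r * C0 * (\<Sum>t\<in>T. h t powr p * \<nu> t) powr (r / p)"
        by (rule one_parameter_embedding[OF U T _ nonempty \<nu>0 h0 p r \<kappa> V geo]) (auto simp: T_def)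
      also have "(\<Sum>t\<in>T. h t powr p * \<nu> t) = (\<Sum>u\<in>B. cell_coeff p g (z(i := u)) powr p)"
      proof -
        have "h t powr p * \<nu> t = cell_coeff p g (z(i := (k0, t))) powr p" for t
        proof -
          have "cell_coeff p g (z(i := (k0, t))) = \<nu> t powr (1 / p) * h t"
            using \<nu>0[of t] by (simp add: cell_coeff_def h_def powr_diff \<nu>_def[symmetric])
          then show ?thesis using \<nu>0[of t] h0[of t] p by (simp add: powr_mult powr_powr)
        qed
        moreover have "inj_on (Pair k0) T" by (auto simp: inj_on_def)
        ultimately show ?thesis by (simp add: B_def sum.reindex)
      qed
      finally show ?thesis by (simp add: cell_coeff_def F C1_def V_def)
    qed
    define z0 :: "'n \<Rightarrow> int \<times> int" where "z0 = (\<lambda>_. (0, 0))"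
    have "(\<Sum>z\<in>Z. cell_coeff p g z powr r) \<le> (\<Sum>z\<in>coords_in U UNIV z0. cell_coeff p g z powr r)"
      using U by (intro sum_mono2 finite_coords_in) (auto simp: coords_in_def U_def)
    also have "\<dots> \<le> C1 ^ card (UNIV :: 'n set) * (\<Sum>z\<in>coords_in B UNIV z0. cell_coeff p g z powr p) powr (r / p)"
      using p r by (intro tensor_embedding U B C1 a0 one) auto
    also have "\<dots> \<le> C1 ^ card (UNIV :: 'n set) * (\<integral>x. g x powr p \<partial>\<mu>) powr (r / p)"
    proof (intro mult_left_mono powr_mono2)
      have finB: "finite (coords_in B UNIV z0)" using B by (rule finite_coords_in)
      have int': "integrable \<mu> (\<lambda>x. indicator (cell z) x * g x powr p)" for z
        using g by (intro integrable_indicator_mult) auto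
      have "(\<Sum>z\<in>coords_in B UNIV z0. cell_coeff p g z powr p) \<le> (\<Sum>z\<in>coords_in B UNIV z0. \<integral>x. indicator (cell z) x * g x powr p \<partial>\<mu>)"
        by (intro sum_mono cell_coeff_powr_le g p)
      also have "\<dots> = (\<integral>x. (\<Sum>z\<in>coords_in B UNIV z0. indicator (cell z) x) * g x powr p \<partial>\<mu>)"
        using int' by (simp add: sum_distrib_right)
      also have "\<dots> = (\<integral>x. indicator (\<Union>z\<in>coords_in B UNIV z0. cell z) x * g x powr p \<partial>\<mu>)"
        using finB by (subst sum_indicator_cells) (auto simp: coords_in_def B_def fun_eq_iff, metis fst_conv imageE)
      also have "\<dots> \<le> (\<integral>x. g x powr p \<partial>\<mu>)"
        using g finB by (intro integral_mono integrable_indicator_mult) (auto simp: indicator_def)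
      finally show "(\<Sum>z\<in>coords_in B UNIV z0. cell_coeff p g z powr p) \<le> (\<integral>x. g x powr p \<partial>\<mu>)" .
    qed (use p r C1 in \<open>auto intro: sum_nonneg\<close>)
    finally show ?thesis .
  qed
  show thesis by (rule that[OF _ main]) (use C1 in auto)
qed

end

section \<open>The kernel and its dyadic model\<close>

definition shift :: "('n \<Rightarrow> int \<times> int) \<Rightarrow> ('n \<Rightarrow> int) \<Rightarrow> 'n \<Rightarrow> int \<times> int"
  where "shift z e i = (fst (z i), snd (z i) + e i)"

definition unit_shifts :: "('n \<Rightarrow> int) set"
  where "unit_shifts = {e. \<forall>i. e i \<in> {-1, 0, 1}}"

lemma finite_unit_shifts: "finite (unit_shifts :: ('n::finite \<Rightarrow> int) set)"
proof -
  have "(unit_shifts :: ('n \<Rightarrow> int) set) = Pi\<^sub>E UNIV (\<lambda>_. {-1, 0, 1})" by (auto simp: unit_shifts_def PiE_def)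
  also have "finite \<dots>" by (intro finite_PiE) auto
  finally show ?thesis .
qed

lemma dyadic_scale_exists:
  assumes "0 < (d::real)" obtains k where "2 powi (k - 1) \<le> d" "d < 2 powi k"
proof
  define k where "k = \<lfloor>log 2 d\<rfloor> + 1"
  have "2 powr real_of_int (k - 1) \<le> d" using assms by (simp add: k_def powr_le_iff le_log_iff[symmetric])
  moreover have "2 powr real_of_int (k - 1) = (2::real) powi (k - 1)" by (rule powr_real_of_int') auto
  ultimately show "2 powi (k - 1) \<le> d" by simp
  have "log 2 d < real_of_int k" by (simp add: k_def)
  then have "d < 2 powr real_of_int k" using assms by (simp add: log_less_iff)
  then show "d < 2 powi k" by (simp add: powr_real_of_int')
qed

context rect_doubling_measure
begin

lemma rect_vol_eq: "rect_vol \<mu> x y = measure \<mu> (closed_rect x (\<chi> i. \<bar>x $ i - y $ i\<bar>))"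
proof -
  define R where "R = closed_rect x (\<chi> i. \<bar>x $ i - y $ i\<bar>)"
  define \<delta> where "\<delta> k = (\<chi> i. \<bar>x $ i - y $ i\<bar> + 1 / real (Suc k))" for k
  define X where "X = {measure \<mu> (rect x \<delta>) |\<delta>. (\<forall>i. 0 < \<delta> $ i) \<and> y \<in> rect x \<delta>}"
  have open_rect: "open (rect x \<delta>)" for \<delta> :: "real^'n"
  proof -
    have "rect x \<delta> = (\<Inter>i. {y. \<bar>x $ i - y $ i\<bar> < \<delta> $ i})" by (auto simp: rect_def)
    then show ?thesis by (auto intro!: open_INT open_Collect_less continuous_intros)
  qed
  have bnd: "bounded (rect x \<delta>)" for \<delta> :: "real^'n"
    by (rule bounded_subset[OF bounded_closed_rect[of x \<delta>]])
       (auto simp: rect_def closed_rect_def less_imp_le)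
  have sets: "rect x \<delta> \<in> sets \<mu>" for \<delta> :: "real^'n" using open_rect by (intro borel_sets_mu) auto
  have \<delta>pos: "0 < \<delta> k $ i" for k i
    unfolding \<delta>_def vec_lambda_beta by (rule add_nonneg_pos) auto
  have mem: "measure \<mu> (rect x (\<delta> k)) \<in> X" for k
    unfolding X_def using \<delta>pos by (auto simp: rect_def \<delta>_def intro!: exI[of _ "\<delta> k"])
  have lower: "measure \<mu> R \<le> v" if "v \<in> X" for v
  proof -
    from that obtain \<delta>' where v: "v = measure \<mu> (rect x \<delta>')" "y \<in> rect x \<delta>'" by (auto simp: X_def)
    have "R \<subseteq> rect x \<delta>'"
      using v(2) by (auto simp: R_def rect_def closed_rect_def intro: le_less_trans)
    then show ?thesis unfolding v(1) by (intro measure_mono sets bnd)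
  qed
  have "(\<lambda>k. measure \<mu> (rect x (\<delta> k))) \<longlonglongrightarrow> measure \<mu> (\<Inter>k. rect x (\<delta> k))"
  proof (rule Lim_measure_decseq)
    show "range (\<lambda>k. rect x (\<delta> k)) \<subseteq> sets \<mu>" using sets by auto
    have mono: "\<delta> n $ i \<le> \<delta> m $ i" if "m \<le> n" for m n i
      unfolding \<delta>_def vec_lambda_beta using that by (intro add_left_mono divide_left_mono) auto
    show "decseq (\<lambda>k. rect x (\<delta> k))"
      unfolding decseq_def
    proof (intro allI impI subsetI)
      fix m n w assume "m \<le> n" "w \<in> rect x (\<delta> n)"
      then show "w \<in> rect x (\<delta> m)"
        using mono[of m n] unfolding rect_def mem_Collect_eq by (metis less_le_trans)
    qed
    show "emeasure \<mu> (rect x (\<delta> k)) \<noteq> \<infinity>" for k using bounded_finite[OF bnd, of "\<delta> k"] by auto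
  qed
  also have "(\<Inter>k. rect x (\<delta> k)) = R"
  proof (intro set_eqI iffI)
    fix w assume w: "w \<in> (\<Inter>k. rect x (\<delta> k))"
    have "\<bar>x $ i - w $ i\<bar> \<le> \<bar>x $ i - y $ i\<bar>" for i
    proof (rule field_le_epsilon)
      fix e :: real assume "0 < e"
      then obtain k where "1 / real (Suc k) < e" using nat_approx_posE by blast
      moreover have "\<bar>x $ i - w $ i\<bar> < \<bar>x $ i - y $ i\<bar> + 1 / real (Suc k)"
        using w by (auto simp: rect_def \<delta>_def)
      ultimately show "\<bar>x $ i - w $ i\<bar> \<le> \<bar>x $ i - y $ i\<bar> + e" by linarith
    qed
    then show "w \<in> R" by (simp add: R_def closed_rect_def)
  next
    fix w assume "w \<in> R"
    then have w: "\<bar>x $ i - w $ i\<bar> \<le> \<bar>x $ i - y $ i\<bar>" for i by (simp add: R_def closed_rect_def)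
    have "\<bar>x $ i - w $ i\<bar> < \<delta> k $ i" for i k
    proof -
      have "0 < 1 / real (Suc k)" by simp
      with w[of i] show ?thesis unfolding \<delta>_def vec_lambda_beta by linarith
    qed
    then show "w \<in> (\<Inter>k. rect x (\<delta> k))" by (simp add: rect_def)
  qed
  finally have lim: "(\<lambda>k. measure \<mu> (rect x (\<delta> k))) \<longlonglongrightarrow> measure \<mu> R" .
  have bdd: "bdd_below X" using lower by (auto simp: bdd_below_def)
  have "Inf X \<le> measure \<mu> R"
    using lim by (rule Lim_bounded2) (auto intro!: cInf_lower mem bdd)
  moreover have "measure \<mu> R \<le> Inf X" using mem lower by (intro cInf_greatest) auto
  ultimately show ?thesis unfolding rect_vol_def X_def[symmetric] R_def[symmetric] by simp
qed

lemma rect_vol_pos: "(\<And>i. x $ i \<noteq> y $ i) \<Longrightarrow> 0 < rect_vol \<mu> x y"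
  unfolding rect_vol_eq by (intro closed_rect_pos) auto

lemma AE_coordinates_differ: "AE y in \<mu>. \<forall>i. x $ i \<noteq> y $ i"
proof -
  have "AE y in \<mu>. x $ i \<noteq> y $ i" for i
    using AE_not_in[OF null_hyperplane[of i "x $ i"]] by eventually_elim auto
  then show ?thesis by (simp add: AE_all_countable)
qed

text \<open>The volume is the mass of a section of the set \<open>Q\<close> in the triple product,
  hence measurable in the remaining two variables.\<close>

lemma rect_vol_measurable: "(\<lambda>w. rect_vol \<mu> (fst w) (snd w)) \<in> borel_measurable (\<mu> \<Otimes>\<^sub>M \<mu>)"
proof -
  interpret sigma_finite_measure \<mu> by (rule sigma_finite)
  have nth: "(\<lambda>x. x $ i) \<in> borel_measurable \<mu>" for i
    by (intro borel_measurable_mu borel_measurable_continuous_onI continuous_intros)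
  define Q where "Q = {w \<in> space ((\<mu> \<Otimes>\<^sub>M \<mu>) \<Otimes>\<^sub>M \<mu>).
    \<forall>i. \<bar>fst (fst w) $ i - snd w $ i\<bar> \<le> \<bar>fst (fst w) $ i - snd (fst w) $ i\<bar>}"
  have [measurable]: "(\<lambda>w. fst (fst w) $ i) \<in> borel_measurable ((\<mu> \<Otimes>\<^sub>M \<mu>) \<Otimes>\<^sub>M \<mu>)"
    "(\<lambda>w. snd (fst w) $ i) \<in> borel_measurable ((\<mu> \<Otimes>\<^sub>M \<mu>) \<Otimes>\<^sub>M \<mu>)"
    "(\<lambda>w. snd w $ i) \<in> borel_measurable ((\<mu> \<Otimes>\<^sub>M \<mu>) \<Otimes>\<^sub>M \<mu>)" for i
    by (auto intro!: measurable_compose[OF _ nth])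
  have "Q \<in> sets ((\<mu> \<Otimes>\<^sub>M \<mu>) \<Otimes>\<^sub>M \<mu>)" unfolding Q_def by measurable
  from measurable_emeasure_Pair[OF this]
  have "(\<lambda>w. measure \<mu> (Pair w -` Q)) \<in> borel_measurable (\<mu> \<Otimes>\<^sub>M \<mu>)"
    unfolding measure_def by measurable
  moreover have "Pair w -` Q = closed_rect (fst w) (\<chi> i. \<bar>fst w $ i - snd w $ i\<bar>)" for w
    by (auto simp: Q_def closed_rect_def space_pair_measure)
  ultimately show ?thesis by (simp add: rect_vol_eq)
qed

text \<open>The distances are those of \<open>cell_neighbour\<close>, now with three doublings in
  every coordinate.\<close>

lemma measure_shift_le:
  fixes e :: "'n \<Rightarrow> int"
  assumes "e \<in> unit_shifts"
  shows "measure \<mu> (cell (shift z e)) \<le> D ^ (3 * CARD('n)) * measure \<mu> (cell z)"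
proof (rule measure_le_of_closed_rect[OF closed_rect_subset_cell])
  show "cell (shift z e) \<subseteq> closed_rect (cell_centre z) (2 ^ 3 *\<^sub>R (\<chi> i. 2 powi fst (z i) / 4))"
  proof
    fix w assume w: "w \<in> cell (shift z e)"
    show "w \<in> closed_rect (cell_centre z) (2 ^ 3 *\<^sub>R (\<chi> i. 2 powi fst (z i) / 4))"
      unfolding closed_rect_def mem_Collect_eq
    proof
      fix i
      define h where "h = (2::real) powi fst (z i)"
      have h: "0 < h" by (simp add: h_def)
      have w': "(real_of_int (snd (z i)) + real_of_int (e i)) * h \<le> w $ i"
         "w $ i < (real_of_int (snd (z i)) + real_of_int (e i) + 1) * h"
        using w by (auto simp: mem_cell_iff shift_def h_def)
      have "e i = -1 \<or> e i = 0 \<or> e i = 1" using assms by (auto simp: unit_shifts_def)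
      then have "\<bar>(real_of_int (snd (z i)) + 1 / 2) * h - w $ i\<bar> \<le> 2 * h"
        using w' h by (elim disjE) (simp_all add: abs_le_iff algebra_simps)
      then show "\<bar>cell_centre z $ i - w $ i\<bar> \<le> (2 ^ 3 *\<^sub>R (\<chi> i. 2 powi fst (z i) / 4)) $ i"
        by (simp add: cell_centre_def h_def)
    qed
  qed
qed (auto simp: bounded_cell)

text \<open>In each coordinate the side length is the power of 2 just above the distance of
  \<open>x\<close> and \<open>y\<close>. Larger than the distance, it puts \<open>y\<close> in the
  same or an adjacent interval; at most twice the distance, it keeps the cell of \<open>x\<close>
  inside the doubled rectangle.\<close>

lemma cell_containing_pair:
  assumes ne: "\<And>i. x $ i \<noteq> y $ i"
  obtains z and e :: "'n \<Rightarrow> int" where "e \<in> unit_shifts" "x \<in> cell z" "y \<in> cell (shift z e)"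
    "measure \<mu> (cell z) \<le> D ^ CARD('n) * rect_vol \<mu> x y"
proof -
  have "\<exists>k. 2 powi (k - 1) \<le> \<bar>x $ i - y $ i\<bar> \<and> \<bar>x $ i - y $ i\<bar> < 2 powi k" for i
    using dyadic_scale_exists[of "\<bar>x $ i - y $ i\<bar>"] ne[of i] by (metis eq_iff_diff_eq_0 zero_less_abs_iff)
  then obtain k where k: "\<And>i. 2 powi (k i - 1) \<le> \<bar>x $ i - y $ i\<bar>" "\<And>i. \<bar>x $ i - y $ i\<bar> < 2 powi k i"
    by metis
  define z where "z i = (k i, \<lfloor>x $ i / 2 powi k i\<rfloor>)" for i
  define e where "e i = \<lfloor>y $ i / 2 powi k i\<rfloor> - \<lfloor>x $ i / 2 powi k i\<rfloor>" for i
  have "e i \<in> {-1, 0, 1}" for i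
  proof -
    have "\<bar>x $ i - y $ i\<bar> / 2 powi k i < 1" using k(2)[of i] by simp
    then have "\<bar>x $ i / 2 powi k i - y $ i / 2 powi k i\<bar> < 1"
      by (simp add: abs_divide flip: diff_divide_distrib)
    then have "-1 \<le> e i \<and> e i \<le> 1" unfolding e_def by linarith
    then show ?thesis by auto
  qed
  then have e: "e \<in> unit_shifts" by (simp add: unit_shifts_def)
  have xz: "x \<in> cell z" by (simp add: cell_def z_def)
  have yz: "y \<in> cell (shift z e)" by (simp add: cell_def z_def shift_def e_def)
  have "measure \<mu> (cell z) \<le> D ^ (1 * CARD('n)) * measure \<mu> (closed_rect x (\<chi> i. \<bar>x $ i - y $ i\<bar>))"
  proof (rule measure_le_of_closed_rect[OF order_refl])
    show "cell z \<subseteq> closed_rect x (2 ^ 1 *\<^sub>R (\<chi> i. \<bar>x $ i - y $ i\<bar>))"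
    proof
      fix w assume w: "w \<in> cell z"
      show "w \<in> closed_rect x (2 ^ 1 *\<^sub>R (\<chi> i. \<bar>x $ i - y $ i\<bar>))"
        unfolding closed_rect_def mem_Collect_eq
      proof
        fix i
        define h where "h = (2::real) powi k i"
        have "h = 2 * 2 powi (k i - 1)" by (simp add: h_def power_int_diff)
        then have "h \<le> 2 * \<bar>x $ i - y $ i\<bar>" using k(1)[of i] by simp
        moreover have "\<bar>x $ i - w $ i\<bar> \<le> h"
        proof -
          define m where "m = real_of_int (snd (z i))"
          have "m * h \<le> x $ i" "x $ i < (m + 1) * h" "m * h \<le> w $ i" "w $ i < (m + 1) * h"
            using xz w unfolding mem_cell_iff m_def h_def by (auto simp: z_def)
          then show ?thesis unfolding abs_le_iff distrib_right by linarith
        qed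
        ultimately show "\<bar>x $ i - w $ i\<bar> \<le> (2 ^ 1 *\<^sub>R (\<chi> i. \<bar>x $ i - y $ i\<bar>)) $ i" by simp
      qed
    qed
  qed (use ne in \<open>auto simp: bounded_closed_rect\<close>)
  then have "measure \<mu> (cell z) \<le> D ^ CARD('n) * rect_vol \<mu> x y" by (simp add: rect_vol_eq)
  with e xz yz show thesis by (rule that)
qed

text \<open>The cut-off at a set \<open>Z\<close>, taken finite in the estimates, makes the sums and
  integrals finite; the full model is reached along \<open>first_cells\<close>.\<close>

definition cell_kernel :: "real \<Rightarrow> ('n \<Rightarrow> int \<times> int) set \<Rightarrow> real^'n \<Rightarrow> real^'n \<Rightarrow> real"
  where "cell_kernel a Z x y = (\<Sum>z\<in>Z. \<Sum>e\<in>unit_shifts.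
    measure \<mu> (cell z) powr (a - 1) * indicator (cell z) x * indicator (cell (shift z e)) y)"

definition cell_operator :: "real \<Rightarrow> ('n \<Rightarrow> int \<times> int) set \<Rightarrow> (real^'n \<Rightarrow> real) \<Rightarrow> real^'n \<Rightarrow> real"
  where "cell_operator a Z g x = (\<Sum>z\<in>Z. \<Sum>e\<in>unit_shifts.
    measure \<mu> (cell z) powr (a - 1) * indicator (cell z) x * cell_integral g (shift z e))"

text \<open>Duality: \<open>T g\<close> is tested against \<open>(T g)\<^sup>q\<^sup>-\<^sup>1\<close>, and the resulting bilinear sum over cells is
  split by Hoelder's inequality with an exponent strictly between \<open>p\<close> and \<open>q\<close>.\<close>

lemma cell_operator_bound:
  assumes p: "1 < p" and q: "p < q" and a: "a = 1 / p - 1 / q"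
  obtains C where "0 \<le> C"
    "\<And>g Z. g \<in> borel_measurable \<mu> \<Longrightarrow> (\<And>x. 0 \<le> g x) \<Longrightarrow> integrable \<mu> (\<lambda>x. g x powr p) \<Longrightarrow> finite Z \<Longrightarrow>
      integrable \<mu> (\<lambda>x. cell_operator a Z g x powr q) \<and>
      (\<integral>x. cell_operator a Z g x powr q \<partial>\<mu>) \<le> C * (\<integral>x. g x powr p \<partial>\<mu>) powr (q / p)"
proof -
  define r where "r = (p + q) / 2"
  have r: "p < r" "r < q" "1 < r" using p q by (auto simp: r_def)
  define r' where "r' = r / (r - 1)"
  define q' where "q' = q / (q - 1)"
  have r': "r' > 1" "1 / r + 1 / r' = 1" using r by (auto simp: r'_def field_simps)
  have q': "q' > 1" "1 / q' = 1 - 1 / q" "(q - 1) * q' = q" using p q by (auto simp: q'_def field_simps)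
  \<comment> \<open>Conjugation reverses the order of \<open>r\<close> and \<open>q\<close>, so the
    embedding is available on the dual side.\<close>
  have q'r': "q' < r'"
  proof -
    have "q * (r - 1) < r * (q - 1)" using r by (simp add: algebra_simps)
    then show ?thesis using r p q by (simp add: q'_def r'_def divide_simps)
  qed
  obtain C1 where C1: "0 \<le> C1"
    "\<And>g Z. g \<in> borel_measurable \<mu> \<Longrightarrow> (\<And>x. 0 \<le> g x) \<Longrightarrow> integrable \<mu> (\<lambda>x. g x powr p) \<Longrightarrow> finite Z \<Longrightarrow>
      (\<Sum>z\<in>Z. cell_coeff p g z powr r) \<le> C1 * (\<integral>x. g x powr p \<partial>\<mu>) powr (r / p)"
    using cell_embedding[OF p r(1)] by blast
  obtain C2 where C2: "0 \<le> C2"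
    "\<And>g Z. g \<in> borel_measurable \<mu> \<Longrightarrow> (\<And>x. 0 \<le> g x) \<Longrightarrow> integrable \<mu> (\<lambda>x. g x powr q') \<Longrightarrow> finite Z \<Longrightarrow>
      (\<Sum>z\<in>Z. cell_coeff q' g z powr r') \<le> C2 * (\<integral>x. g x powr q' \<partial>\<mu>) powr (r' / q')"
    using cell_embedding[OF q'(1) q'r'] by blast
  \<comment> \<open>The price of replacing the mass of a cell by that of its neighbour in the
    normalising power, whose exponent \<open>1 / p - 1\<close> is negative.\<close>
  define N where "N = (D ^ (3 * CARD('n))) powr (1 - 1 / p)"
  have N: "0 \<le> N" by (simp add: N_def)
  define C where "C = (real (card (unit_shifts :: ('n \<Rightarrow> int) set)) * (N * (C1 powr (1 / r) * C2 powr (1 / r')))) powr q"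
  have main: "integrable \<mu> (\<lambda>x. cell_operator a Z g x powr q) \<and>
      (\<integral>x. cell_operator a Z g x powr q \<partial>\<mu>) \<le> C * (\<integral>x. g x powr p \<partial>\<mu>) powr (q / p)"
    if g: "g \<in> borel_measurable \<mu>" "\<And>x. 0 \<le> g x" "integrable \<mu> (\<lambda>x. g x powr p)" and Z: "finite Z" for g Z
  proof -
    define h where "h = cell_operator a Z g"
    define c where "c z e = measure \<mu> (cell z) powr (a - 1) * cell_integral g (shift z e)" for z e
    have F0: "0 \<le> cell_integral g z" for z
      unfolding cell_integral_def using g by (intro integral_nonneg_AE) auto
    have c0: "0 \<le> c z e" for z e using F0 by (simp add: c_def)
    have h_eq: "h x = (\<Sum>z\<in>Z. \<Sum>e\<in>unit_shifts. c z e * indicator (cell z) x)" for x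
      by (simp add: h_def cell_operator_def c_def mult_ac)
    have h0: "0 \<le> h x" for x unfolding h_eq using c0 by (intro sum_nonneg mult_nonneg_nonneg) auto
    have hm: "h \<in> borel_measurable \<mu>" unfolding h_eq[abs_def] by measurable
    define S where "S = (\<Union>z\<in>Z. cell z)"
    have S: "S \<in> sets \<mu>" "bounded S" using Z by (auto simp: S_def bounded_cell)
    define H where "H = (\<Sum>z\<in>Z. \<Sum>e\<in>unit_shifts. c z e)"
    have hH: "h x \<le> H" for x
      unfolding h_eq H_def using c0 by (intro sum_mono mult_left_le) (auto simp: indicator_def)
    have hS: "h x = 0" if "x \<notin> S" for x using that by (auto simp: h_eq S_def intro!: sum.neutral)
    \<comment> \<open>\<open>h\<close> is bounded and vanishes off a bounded set, so its powers are
      integrable before any estimate. The final cancellation of a power of \<open>I\<close> needs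
      this finiteness.\<close>
    have hpow: "integrable \<mu> (\<lambda>x. h x powr s)" if "0 < s" for s
    proof (rule Bochner_Integration.integrable_bound)
      show "integrable \<mu> (\<lambda>x. H powr s * indicator S x)" using S by (intro integrable_mult_right integrable_indicator_bounded)
      show "(\<lambda>x. h x powr s) \<in> borel_measurable \<mu>" using hm by measurable
      show "AE x in \<mu>. norm (h x powr s) \<le> norm (H powr s * indicator S x)"
        using hS hH h0 that by (auto simp: indicator_def intro!: powr_mono2)
    qed
    \<comment> \<open>The extremal function for duality: \<open>G powr q'\<close> equals
      \<open>h powr q\<close>, so the norm of \<open>G\<close> is expressed by \<open>I\<close>
      again.\<close>
    define G where "G x = h x powr (q - 1)" for x
    have Gq: "G x powr q' = h x powr q" for x by (simp add: G_def powr_powr q')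
    have G: "G \<in> borel_measurable \<mu>" "\<And>x. 0 \<le> G x" "integrable \<mu> (\<lambda>x. G x powr q')"
      using hm hpow[of q] p q by (auto simp: G_def[abs_def] powr_powr q')
    have intG: "integrable \<mu> (\<lambda>x. indicator (cell z) x * G x)" for z
      using q' by (intro Lp_integrable_on_bounded[OF G] bounded_cell) auto
    have FG0: "0 \<le> cell_integral G z" for z
      unfolding cell_integral_def using G by (intro integral_nonneg_AE) auto
    define I where "I = (\<integral>x. h x powr q \<partial>\<mu>)"
    define P where "P = (\<integral>x. g x powr p \<partial>\<mu>)"
    have I0: "0 \<le> I" and P0: "0 \<le> P" by (auto simp: I_def P_def)
    have "I = (\<integral>x. h x * G x \<partial>\<mu>)"
      unfolding I_def G_def
    proof (rule Bochner_Integration.integral_cong[OF refl])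
      fix x show "h x powr q = h x * h x powr (q - 1)"
        using h0[of x] p q by (cases "h x = 0") (auto simp: powr_diff)
    qed
    also have "\<dots> = (\<integral>x. (\<Sum>z\<in>Z. \<Sum>e\<in>unit_shifts. c z e * (indicator (cell z) x * G x)) \<partial>\<mu>)"
      by (simp add: h_eq sum_distrib_left sum_distrib_right mult_ac)
    also have "\<dots> = (\<Sum>z\<in>Z. \<Sum>e\<in>unit_shifts. c z e * cell_integral G z)"
      unfolding cell_integral_def using intG by simp
    also have "\<dots> = (\<Sum>e\<in>unit_shifts. \<Sum>z\<in>Z. c z e * cell_integral G z)" by (rule sum.swap)
    also have "\<dots> \<le> (\<Sum>e\<in>unit_shifts. \<Sum>z\<in>Z. N * (cell_coeff p g (shift z e) * cell_coeff q' G z))"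
    proof (intro sum_mono)
      fix e :: "'n \<Rightarrow> int" and z assume e: "e \<in> unit_shifts"
      define m where "m = measure \<mu> (cell z)"
      define m' where "m' = measure \<mu> (cell (shift z e))"
      have m: "0 < m" "0 < m'" by (auto simp: m_def m'_def cell_pos)
      define M where "M = D ^ (3 * CARD('n))"
      have M: "0 < M" using D1 by (simp add: M_def)
      have "m' / M \<le> m" using measure_shift_le[OF e, of z] M by (simp add: m_def m'_def M_def field_simps)
      then have "m powr (1 / p - 1) \<le> (m' / M) powr (1 / p - 1)"
        using m M p by (intro powr_mono2') auto
      also have "\<dots> = N * m' powr (1 / p - 1)"
      proof -
        have "M powr (1 / p - 1) = 1 / N" unfolding N_def M_def[symmetric]
          using powr_minus_divide[of M "1 - 1 / p"] by simp
        then show ?thesis using m M by (simp add: powr_divide N_def)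
      qed
      finally have 1: "m powr (1 / p - 1) \<le> N * m' powr (1 / p - 1)" .
      \<comment> \<open>Here the exponent relation enters. The power of the mass splits into the
        normalisation for \<open>p\<close>, passed on to the neighbour, and that for
        \<open>q'\<close>, kept on the cell itself.\<close>
      have "a - 1 = (1 / p - 1) + (1 / q' - 1)" using q' a by simp
      then have "c z e * cell_integral G z = m powr (1 / p - 1) * (m powr (1 / q' - 1) * cell_integral g (shift z e) * cell_integral G z)"
        unfolding c_def m_def[symmetric] by (simp only: powr_add mult_ac)
      also have "\<dots> \<le> N * m' powr (1 / p - 1) * (m powr (1 / q' - 1) * cell_integral g (shift z e) * cell_integral G z)"
        using F0 FG0 by (intro mult_right_mono 1) auto
      also have "\<dots> = N * (cell_coeff p g (shift z e) * cell_coeff q' G z)"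
        by (simp add: cell_coeff_def m_def m'_def mult_ac)
      finally show "c z e * cell_integral G z \<le> N * (cell_coeff p g (shift z e) * cell_coeff q' G z)" .
    qed
    also have "\<dots> = (\<Sum>e\<in>unit_shifts. N * (\<Sum>z\<in>Z. cell_coeff p g (shift z e) * cell_coeff q' G z))"
      by (simp add: sum_distrib_left)
    also have "\<dots> \<le> (\<Sum>e\<in>(unit_shifts :: ('n \<Rightarrow> int) set). N * (C1 powr (1 / r) * P powr (1 / p) * (C2 powr (1 / r') * I powr (1 / q'))))"
    proof (intro sum_mono mult_left_mono N)
      fix e :: "'n \<Rightarrow> int" assume "e \<in> unit_shifts"
      have "(\<Sum>z\<in>Z. cell_coeff p g (shift z e) * cell_coeff q' G z)
        \<le> (\<Sum>z\<in>Z. cell_coeff p g (shift z e) powr r) powr (1 / r) * (\<Sum>z\<in>Z. cell_coeff q' G z powr r') powr (1 / r')"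
        using Z r r' F0 FG0 by (intro Holder_sum) (auto simp: cell_coeff_def)
      also have "\<dots> \<le> (C1 * P powr (r / p)) powr (1 / r) * (C2 * I powr (r' / q')) powr (1 / r')"
      proof (intro mult_mono powr_mono2)
        have inj: "inj_on (\<lambda>z. shift z e) Z"
          by (auto simp: inj_on_def shift_def fun_eq_iff prod_eq_iff)
        have "(\<Sum>z\<in>Z. cell_coeff p g (shift z e) powr r) = (\<Sum>z\<in>(\<lambda>z. shift z e) ` Z. cell_coeff p g z powr r)"
          by (simp add: sum.reindex[OF inj])
        also have "\<dots> \<le> C1 * P powr (r / p)" unfolding P_def using Z g by (intro C1) auto
        finally show "(\<Sum>z\<in>Z. cell_coeff p g (shift z e) powr r) \<le> C1 * P powr (r / p)" .
        show "(\<Sum>z\<in>Z. cell_coeff q' G z powr r') \<le> C2 * I powr (r' / q')"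
          using C2(2)[OF G Z] by (simp add: Gq I_def)
      qed (use r r' in \<open>auto intro: sum_nonneg\<close>)
      also have "\<dots> = C1 powr (1 / r) * P powr (1 / p) * (C2 powr (1 / r') * I powr (1 / q'))"
        using r r' by (simp add: powr_mult powr_powr)
      finally show "(\<Sum>z\<in>Z. cell_coeff p g (shift z e) * cell_coeff q' G z)
        \<le> C1 powr (1 / r) * P powr (1 / p) * (C2 powr (1 / r') * I powr (1 / q'))" .
    qed
    also have "\<dots> = C powr (1 / q) * P powr (1 / p) * I powr (1 - 1 / q)"
    proof -
      have "C powr (1 / q) = real (card (unit_shifts :: ('n \<Rightarrow> int) set)) * (N * (C1 powr (1 / r) * C2 powr (1 / r')))"
        using p q N by (simp add: C_def powr_powr)
      then show ?thesis by (simp add: q' mult_ac)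
    qed
    finally have I_le: "I \<le> C powr (1 / q) * P powr (1 / p) * I powr (1 - 1 / q)" .
    have "I \<le> C * P powr (q / p)"
    proof (cases "I = 0")
      case True
      then show ?thesis using P0 by (simp add: C_def)
    next
      case False
      with I0 have I: "0 < I" by simp
      then have "I powr (1 / q) * I powr (1 - 1 / q) \<le> C powr (1 / q) * P powr (1 / p) * I powr (1 - 1 / q)"
        using I_le by (simp flip: powr_add)
      then have "I powr (1 / q) \<le> C powr (1 / q) * P powr (1 / p)"
        using I by (simp add: mult_le_cancel_right)
      then have "(I powr (1 / q)) powr q \<le> (C powr (1 / q) * P powr (1 / p)) powr q"
        using p q by (intro powr_mono2) auto
      then show ?thesis using I p q N by (simp add: powr_mult powr_powr C_def)
    qed
    then show ?thesis using hpow[of q] p q by (simp add: I_def P_def h_def)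
  qed
  show thesis by (rule that[OF _ main]) (auto simp: C_def)
qed

end

section \<open>Sufficiency\<close>

context rect_doubling_measure
begin

text \<open>Increasing finite sets that exhaust the countable set of cells, for use in monotone
  convergence.\<close>

definition first_cells :: "nat \<Rightarrow> ('n \<Rightarrow> int \<times> int) set"
  where "first_cells j = {z. to_nat z < j}"

lemma finite_first_cells: "finite (first_cells j)"
  unfolding first_cells_def
  using finite_vimageI[OF finite_lessThan[of j] inj_to_nat] by (simp add: vimage_def)

lemma cell_kernel_mono:
  "Z \<subseteq> Z' \<Longrightarrow> finite Z' \<Longrightarrow> cell_kernel a Z x y \<le> cell_kernel a Z' x y"
  unfolding cell_kernel_def by (intro sum_mono2) (auto intro!: sum_nonneg)

lemma cell_kernel_nonneg: "0 \<le> cell_kernel a Z x y"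
  unfolding cell_kernel_def by (intro sum_nonneg) auto

text \<open>One term of the model is enough, that of the cell found for the pair. Its number depends
  on \<open>x\<close> and \<open>y\<close>, so an estimate for all \<open>y\<close> takes the
  supremum over \<open>j\<close>.\<close>

lemma kernel_le_cell_kernel:
  assumes ne: "\<And>i. x $ i \<noteq> y $ i" and a: "a < 1"
  obtains j where "(1 / rect_vol \<mu> x y) powr (1 - a) \<le> (D ^ CARD('n)) powr (1 - a) * cell_kernel a (first_cells j) x y"
proof -
  obtain z and e :: "'n \<Rightarrow> int" where ze: "e \<in> unit_shifts" "x \<in> cell z" "y \<in> cell (shift z e)"
    and le: "measure \<mu> (cell z) \<le> D ^ CARD('n) * rect_vol \<mu> x y"
    using cell_containing_pair[OF ne] by blast
  define m where "m = measure \<mu> (cell z)"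
  define M where "M = D ^ CARD('n)"
  have m: "0 < m" by (simp add: m_def cell_pos)
  have M: "0 < M" using D1 by (simp add: M_def)
  have V: "0 < rect_vol \<mu> x y" by (rule rect_vol_pos[OF ne])
  have "1 / rect_vol \<mu> x y \<le> M / m" using le V m by (simp add: m_def M_def divide_simps mult_ac)
  then have "(1 / rect_vol \<mu> x y) powr (1 - a) \<le> (M / m) powr (1 - a)"
    using V a by (intro powr_mono2) auto
  also have "\<dots> = M powr (1 - a) * m powr (a - 1)"
    using m M powr_minus_divide[of m "1 - a"] by (simp add: powr_divide)
  also have "m powr (a - 1) \<le> cell_kernel a (first_cells (Suc (to_nat z))) x y"
  proof -
    have "m powr (a - 1) = m powr (a - 1) * indicator (cell z) x * indicator (cell (shift z e)) y"
      using ze by simp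
    also have "\<dots> \<le> (\<Sum>e\<in>unit_shifts. m powr (a - 1) * indicator (cell z) x * indicator (cell (shift z e)) y)"
      using ze(1) finite_unit_shifts
      by (intro member_le_sum[where f="\<lambda>e. m powr (a - 1) * indicator (cell z) x * indicator (cell (shift z e)) y"]) auto
    also have "\<dots> \<le> cell_kernel a (first_cells (Suc (to_nat z))) x y"
      unfolding cell_kernel_def m_def
      by (intro member_le_sum[where f="\<lambda>z. \<Sum>e\<in>unit_shifts. measure \<mu> (cell z) powr (a - 1) * indicator (cell z) x * indicator (cell (shift z e)) y"])
         (auto simp: first_cells_def finite_first_cells[unfolded first_cells_def] intro!: sum_nonneg)
    finally show ?thesis .
  qed
  finally show thesis by (intro that) (simp add: M_def mult_left_mono)
qed

lemma integral_cell_kernel: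
  assumes "\<And>z. integrable \<mu> (\<lambda>x. indicator (cell z) x * g x)"
  shows "integrable \<mu> (\<lambda>y. g y * cell_kernel a Z x y)"
    and "(\<integral>y. g y * cell_kernel a Z x y \<partial>\<mu>) = cell_operator a Z g x"
proof -
  have eq: "g y * cell_kernel a Z x y = (\<Sum>z\<in>Z. \<Sum>e\<in>unit_shifts.
      (measure \<mu> (cell z) powr (a - 1) * indicator (cell z) x) * (indicator (cell (shift z e)) y * g y))" for y
    by (simp add: cell_kernel_def sum_distrib_left mult_ac)
  show "integrable \<mu> (\<lambda>y. g y * cell_kernel a Z x y)"
    unfolding eq using assms by (intro Bochner_Integration.integrable_sum integrable_mult_right)
  show "(\<integral>y. g y * cell_kernel a Z x y \<partial>\<mu>) = cell_operator a Z g x"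
    unfolding eq cell_operator_def using assms by (simp add: cell_integral_def)
qed

text \<open>Stated in \<open>ennreal\<close> because convergence of the kernel integral is still
  unknown; it will be deduced from finiteness of the right-hand side.\<close>

lemma nn_integral_kernel_le:
  assumes g: "\<And>z. integrable \<mu> (\<lambda>x. indicator (cell z) x * g x)" "g \<in> borel_measurable \<mu>" "\<And>x. 0 \<le> g x" and a: "a < 1"
  shows "(\<integral>\<^sup>+y. ennreal (g y * (1 / rect_vol \<mu> x y) powr (1 - a)) \<partial>\<mu>)
    \<le> (SUP j. ennreal ((D ^ CARD('n)) powr (1 - a) * cell_operator a (first_cells j) g x))"
proof -
  define M where "M = (D ^ CARD('n)) powr (1 - a)"
  have M: "0 \<le> M" by (simp add: M_def)
  define \<phi> where "\<phi> j y = ennreal (M * (g y * cell_kernel a (first_cells j) x y))" for j y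
  have int: "integrable \<mu> (\<lambda>y. M * (g y * cell_kernel a (first_cells j) x y))" for j
    using integral_cell_kernel(1)[OF g(1)] by (intro integrable_mult_right)
  have "(\<integral>\<^sup>+y. ennreal (g y * (1 / rect_vol \<mu> x y) powr (1 - a)) \<partial>\<mu>) \<le> (\<integral>\<^sup>+y. (SUP j. \<phi> j y) \<partial>\<mu>)"
  proof (rule nn_integral_mono_AE)
    show "AE y in \<mu>. ennreal (g y * (1 / rect_vol \<mu> x y) powr (1 - a)) \<le> (SUP j. \<phi> j y)"
      using AE_coordinates_differ[of x]
    proof eventually_elim
      case (elim y)
      then obtain j where j: "(1 / rect_vol \<mu> x y) powr (1 - a) \<le> M * cell_kernel a (first_cells j) x y"
        using kernel_le_cell_kernel[of x y a] a unfolding M_def by metis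
      have "g y * (1 / rect_vol \<mu> x y) powr (1 - a) \<le> g y * (M * cell_kernel a (first_cells j) x y)"
        using g(3) j by (intro mult_left_mono) auto
      then have "ennreal (g y * (1 / rect_vol \<mu> x y) powr (1 - a)) \<le> \<phi> j y"
        unfolding \<phi>_def by (intro ennreal_leI) (simp add: mult_ac)
      then show ?case by (rule order_trans) (rule SUP_upper, simp)
    qed
  qed
  also have "\<dots> = (SUP j. \<integral>\<^sup>+y. \<phi> j y \<partial>\<mu>)"
  proof (rule nn_integral_monotone_convergence_SUP)
    show "incseq \<phi>"
    proof (intro incseq_SucI le_funI)
      fix j y
      have "cell_kernel a (first_cells j) x y \<le> cell_kernel a (first_cells (Suc j)) x y"
        by (intro cell_kernel_mono finite_first_cells) (auto simp: first_cells_def)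
      then show "\<phi> j y \<le> \<phi> (Suc j) y" unfolding \<phi>_def using M g(3)
        by (intro ennreal_leI mult_left_mono) auto
    qed
    show "\<phi> j \<in> borel_measurable \<mu>" for j
      unfolding \<phi>_def using borel_measurable_integrable[OF int] by measurable
  qed
  also have "\<dots> = (SUP j. ennreal (M * cell_operator a (first_cells j) g x))"
  proof (rule SUP_cong[OF refl])
    fix j
    show "(\<integral>\<^sup>+y. \<phi> j y \<partial>\<mu>) = ennreal (M * cell_operator a (first_cells j) g x)"
      unfolding \<phi>_def using int g(3) M cell_kernel_nonneg
      by (subst nn_integral_eq_integral) (auto simp: integral_cell_kernel(2)[OF g(1)])
  qed
  finally show ?thesis by (simp add: M_def)
qed

lemma frac_integrand_measurable:
  assumes "f \<in> borel_measurable \<mu>"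
  shows "(\<lambda>(x, y). frac_integrand \<mu> \<alpha> f x y) \<in> borel_measurable (\<mu> \<Otimes>\<^sub>M \<mu>)"
    and "frac_integrand \<mu> \<alpha> f x \<in> borel_measurable \<mu>"
    and "frac_integral \<mu> \<alpha> f \<in> borel_measurable \<mu>"
proof -
  interpret sigma_finite_measure \<mu> by (rule sigma_finite)
  note [measurable] = rect_vol_measurable assms
  show 1: "(\<lambda>(x, y). frac_integrand \<mu> \<alpha> f x y) \<in> borel_measurable (\<mu> \<Otimes>\<^sub>M \<mu>)"
    unfolding frac_integrand_def case_prod_unfold by measurable
  show "frac_integrand \<mu> \<alpha> f x \<in> borel_measurable \<mu>"
    using measurable_compose[OF measurable_Pair1' 1, of x] by simp
  show "frac_integral \<mu> \<alpha> f \<in> borel_measurable \<mu>"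
    unfolding frac_integral_def[abs_def] using 1 by (rule borel_measurable_lebesgue_integral)
qed

lemma norm_frac_integrand:
  "norm (frac_integrand \<mu> \<alpha> f x y) = norm (f y) * (1 / rect_vol \<mu> x y) powr (1 - \<alpha> / real CARD('n))"
  by (simp add: frac_integrand_def norm_mult)

text \<open>The uniform bounds for the truncated operators pass to their supremum by monotone
  convergence. The supremum is therefore finite almost everywhere, and where it is finite it yields
  both the absolute convergence of the integral and its size.\<close>

theorem frac_integral_bounded:
  assumes p: "1 < p" and q: "p < q" and \<alpha>: "\<alpha> / real CARD('n) = 1 / p - 1 / q"
  shows "\<exists>C::real. \<forall>f \<in> Lp_space \<mu> p.
            (AE x in \<mu>. integrable \<mu> (frac_integrand \<mu> \<alpha> f x)) \<and>
            frac_integral \<mu> \<alpha> f \<in> Lp_space \<mu> q \<and>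
            Lp_norm \<mu> q (frac_integral \<mu> \<alpha> f) \<le> C * Lp_norm \<mu> p f"
proof -
  define a where "a = 1 / p - 1 / q"
  have a1: "a < 1"
  proof -
    have "1 / p < 1" "0 < 1 / q" using p q by auto
    then show ?thesis unfolding a_def by linarith
  qed
  obtain C where C: "0 \<le> C"
    "\<And>g Z. g \<in> borel_measurable \<mu> \<Longrightarrow> (\<And>x. 0 \<le> g x) \<Longrightarrow> integrable \<mu> (\<lambda>x. g x powr p) \<Longrightarrow> finite Z \<Longrightarrow>
      integrable \<mu> (\<lambda>x. cell_operator a Z g x powr q) \<and>
      (\<integral>x. cell_operator a Z g x powr q \<partial>\<mu>) \<le> C * (\<integral>x. g x powr p \<partial>\<mu>) powr (q / p)"
    using cell_operator_bound[OF p q a_def] by blast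
  define M where "M = (D ^ CARD('n)) powr (1 - a)"
  have M: "0 \<le> M" by (simp add: M_def)
  have "(AE x in \<mu>. integrable \<mu> (frac_integrand \<mu> \<alpha> f x)) \<and>
            frac_integral \<mu> \<alpha> f \<in> Lp_space \<mu> q \<and>
            Lp_norm \<mu> q (frac_integral \<mu> \<alpha> f) \<le> (M * C powr (1 / q)) * Lp_norm \<mu> p f"
    if f: "f \<in> Lp_space \<mu> p" for f
  proof -
    define g where "g x = norm (f x)" for x
    have fm: "f \<in> borel_measurable \<mu>" using f by (simp add: Lp_space_def)
    have g: "g \<in> borel_measurable \<mu>" "\<And>x. 0 \<le> g x" "integrable \<mu> (\<lambda>x. g x powr p)"
      using f by (auto simp: Lp_space_def g_def[abs_def])
    have intg: "integrable \<mu> (\<lambda>x. indicator (cell z) x * g x)" for z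
      using p by (intro Lp_integrable_on_bounded[OF g] bounded_cell) auto
    define P where "P = (\<integral>x. g x powr p \<partial>\<mu>)"
    define T where "T j = cell_operator a (first_cells j) g" for j
    have F0: "0 \<le> cell_integral g z" for z
      unfolding cell_integral_def using g by (intro integral_nonneg_AE) auto
    have T0: "0 \<le> T j x" for j x
      unfolding T_def cell_operator_def using F0 by (intro sum_nonneg mult_nonneg_nonneg) auto
    have Tmono: "T j x \<le> T (Suc j) x" for j x
      unfolding T_def cell_operator_def
      using F0 by (intro sum_mono2 finite_first_cells) (auto simp: first_cells_def intro!: sum_nonneg)
    have Tq: "integrable \<mu> (\<lambda>x. T j x powr q)" "(\<integral>x. T j x powr q \<partial>\<mu>) \<le> C * P powr (q / p)" for j
      using C(2)[OF g finite_first_cells] by (auto simp: T_def P_def)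
    define W where "W x = (SUP j. ennreal (T j x powr q))" for x
    have "(\<integral>\<^sup>+x. W x \<partial>\<mu>) = (SUP j. \<integral>\<^sup>+x. ennreal (T j x powr q) \<partial>\<mu>)"
      unfolding W_def
    proof (rule nn_integral_monotone_convergence_SUP)
      show "incseq (\<lambda>j x. ennreal (T j x powr q))"
        using T0 Tmono p q by (intro incseq_SucI le_funI ennreal_leI powr_mono2) auto
      show "(\<lambda>x. ennreal (T j x powr q)) \<in> borel_measurable \<mu>" for j
        using borel_measurable_integrable[OF Tq(1)] by measurable
    qed
    also have "\<dots> \<le> ennreal (C * P powr (q / p))"
      using Tq by (intro SUP_least) (auto simp: nn_integral_eq_integral intro: ennreal_leI)
    finally have W: "(\<integral>\<^sup>+x. W x \<partial>\<mu>) \<le> ennreal (C * P powr (q / p))" .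
    have Wm: "W \<in> borel_measurable \<mu>"
      unfolding W_def using borel_measurable_integrable[OF Tq(1)] by measurable
    have Wfin: "AE x in \<mu>. W x \<noteq> \<infinity>"
      using W by (intro nn_integral_PInf_AE Wm) (auto simp: top_unique)
    have key: "integrable \<mu> (frac_integrand \<mu> \<alpha> f x) \<and>
        ennreal (norm (frac_integral \<mu> \<alpha> f x) powr q) \<le> ennreal (M powr q) * W x" if "W x \<noteq> \<infinity>" for x
    proof -
      define Y where "Y = enn2real (W x)"
      have Y: "W x = ennreal Y" "0 \<le> Y" using that by (auto simp: Y_def less_top)
      have "T j x \<le> Y powr (1 / q)" for j
      proof -
        have "ennreal (T j x powr q) \<le> W x" unfolding W_def by (rule SUP_upper) simp
        then have "T j x powr q \<le> Y" using Y by simp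
        then have "(T j x powr q) powr (1 / q) \<le> Y powr (1 / q)" using p q by (intro powr_mono2) auto
        then show ?thesis using T0[of j x] p q by (simp add: powr_powr)
      qed
      then have "(SUP j. ennreal (M * T j x)) \<le> ennreal (M * Y powr (1 / q))"
        using M by (intro SUP_least ennreal_leI mult_left_mono) auto
      with nn_integral_kernel_le[OF intg g(1,2) a1, of x]
      have "(\<integral>\<^sup>+y. ennreal (g y * (1 / rect_vol \<mu> x y) powr (1 - a)) \<partial>\<mu>) \<le> ennreal (M * Y powr (1 / q))"
        unfolding T_def M_def by (rule order_trans)
      then have nn: "(\<integral>\<^sup>+y. ennreal (norm (frac_integrand \<mu> \<alpha> f x y)) \<partial>\<mu>) \<le> ennreal (M * Y powr (1 / q))"
        by (simp add: norm_frac_integrand g_def \<alpha> a_def)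
      have int: "integrable \<mu> (frac_integrand \<mu> \<alpha> f x)"
        using nn by (intro integrableI_bounded frac_integrand_measurable fm) (auto intro: le_less_trans)
      have "ennreal (norm (frac_integral \<mu> \<alpha> f x)) \<le> ennreal (M * Y powr (1 / q))"
        unfolding frac_integral_def using integral_norm_bound_ennreal[OF int] nn by (rule order_trans)
      then have "norm (frac_integral \<mu> \<alpha> f x) \<le> M * Y powr (1 / q)" using M by (simp add: ennreal_le_iff)
      then have "norm (frac_integral \<mu> \<alpha> f x) powr q \<le> (M * Y powr (1 / q)) powr q"
        using p q by (intro powr_mono2) auto
      also have "\<dots> = M powr q * Y" using p q Y by (simp add: powr_mult powr_powr)
      finally show ?thesis using int Y M by (simp add: ennreal_leI flip: ennreal_mult)
    qed
    have ae1: "AE x in \<mu>. integrable \<mu> (frac_integrand \<mu> \<alpha> f x)"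
      using Wfin by eventually_elim (use key in auto)
    have ae2: "AE x in \<mu>. ennreal (norm (frac_integral \<mu> \<alpha> f x) powr q) \<le> ennreal (M powr q) * W x"
      using Wfin by eventually_elim (use key in auto)
    have P0: "0 \<le> P" by (simp add: P_def)
    have "(\<integral>\<^sup>+x. ennreal (norm (frac_integral \<mu> \<alpha> f x) powr q) \<partial>\<mu>) \<le> (\<integral>\<^sup>+x. ennreal (M powr q) * W x \<partial>\<mu>)"
      using ae2 by (rule nn_integral_mono_AE)
    also have "\<dots> = ennreal (M powr q) * (\<integral>\<^sup>+x. W x \<partial>\<mu>)" using Wm by (rule nn_integral_cmult)
    also have "\<dots> \<le> ennreal (M powr q) * ennreal (C * P powr (q / p))" by (intro mult_left_mono W) simp
    also have "\<dots> = ennreal (M powr q * (C * P powr (q / p)))" using C(1) by (simp add: ennreal_mult)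
    finally have nn: "(\<integral>\<^sup>+x. ennreal (norm (frac_integral \<mu> \<alpha> f x) powr q) \<partial>\<mu>) \<le> ennreal (M powr q * (C * P powr (q / p)))" .
    note fim = frac_integrand_measurable(3)[OF fm, of \<alpha>]
    have int: "integrable \<mu> (\<lambda>x. norm (frac_integral \<mu> \<alpha> f x) powr q)"
      using nn fim by (intro integrableI_bounded) (auto intro: le_less_trans)
    have "(\<integral>x. norm (frac_integral \<mu> \<alpha> f x) powr q \<partial>\<mu>) \<le> M powr q * (C * P powr (q / p))"
      using nn C(1) int by (subst (asm) nn_integral_eq_integral) (auto simp: ennreal_le_iff)
    then have "Lp_norm \<mu> q (frac_integral \<mu> \<alpha> f) \<le> (M powr q * (C * P powr (q / p))) powr (1 / q)"
      unfolding Lp_norm_def using p q by (intro powr_mono2) auto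
    also have "\<dots> = M * C powr (1 / q) * P powr (1 / p)"
      using p q M by (simp add: powr_mult powr_powr)
    also have "P powr (1 / p) = Lp_norm \<mu> p f" by (simp add: Lp_norm_def P_def g_def)
    finally show ?thesis using ae1 fim int by (simp add: Lp_space_def)
  qed
  then show ?thesis by blast
qed

section \<open>Necessity of the exponent relation\<close>

text \<open>The rectangle around \<open>x\<close> leaves the cell by at most one side, so it stays
  within one and a half sides of the centre.\<close>

lemma rect_vol_le_cell:
  assumes "x \<in> cell z" "y \<in> cell z"
  shows "rect_vol \<mu> x y \<le> D ^ (3 * CARD('n)) * measure \<mu> (cell z)"
  unfolding rect_vol_eq
proof (rule measure_le_of_closed_rect[OF closed_rect_subset_cell])
  show "closed_rect x (\<chi> i. \<bar>x $ i - y $ i\<bar>) \<subseteq> closed_rect (cell_centre z) (2 ^ 3 *\<^sub>R (\<chi> i. 2 powi fst (z i) / 4))"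
  proof
    fix w assume w: "w \<in> closed_rect x (\<chi> i. \<bar>x $ i - y $ i\<bar>)"
    show "w \<in> closed_rect (cell_centre z) (2 ^ 3 *\<^sub>R (\<chi> i. 2 powi fst (z i) / 4))"
      unfolding closed_rect_def mem_Collect_eq
    proof
      fix i
      have "\<bar>cell_centre z $ i - x $ i\<bar> \<le> 2 powi fst (z i) / 2" "\<bar>cell_centre z $ i - y $ i\<bar> \<le> 2 powi fst (z i) / 2"
        using assms cell_subset_closed_rect[of z] by (auto simp: closed_rect_def subset_iff)
      moreover have "\<bar>x $ i - w $ i\<bar> \<le> \<bar>x $ i - y $ i\<bar>" using w by (simp add: closed_rect_def)
      moreover have "(2 ^ 3 *\<^sub>R (\<chi> i. 2 powi fst (z i) / 4)) $ i = (2 * 2 powi fst (z i) :: real)" by simp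
      ultimately show "\<bar>cell_centre z $ i - w $ i\<bar> \<le> (2 ^ 3 *\<^sub>R (\<chi> i. 2 powi fst (z i) / 4)) $ i" by linarith
    qed
  qed
qed (auto simp: bounded_cell)

lemma indicator_cell_Lp:
  assumes "0 < p"
  shows "(\<lambda>x. complex_of_real (indicator (cell z) x)) \<in> Lp_space \<mu> p"
    and "Lp_norm \<mu> p (\<lambda>x. complex_of_real (indicator (cell z) x)) = measure \<mu> (cell z) powr (1 / p)"
proof -
  have eq: "norm (complex_of_real (indicator (cell z) x)) powr p = indicator (cell z) x" for x
    using assms by (auto simp: indicator_def)
  show "(\<lambda>x. complex_of_real (indicator (cell z) x)) \<in> Lp_space \<mu> p"
    unfolding Lp_space_def mem_Collect_eq eq using bounded_cell[of z]
    by (auto intro!: integrable_indicator_bounded)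
  show "Lp_norm \<mu> p (\<lambda>x. complex_of_real (indicator (cell z) x)) = measure \<mu> (cell z) powr (1 / p)"
    unfolding Lp_norm_def eq by simp
qed

text \<open>For \<open>x\<close> and \<open>y\<close> in the cell the volume is at most
  \<open>M * m\<close>, and the kernel is a nonpositive power of it. Integrating this lower bound
  over the cell contributes one more factor \<open>m\<close>.\<close>

lemma frac_integral_indicator_cell_ge:
  assumes int: "integrable \<mu> (frac_integrand \<mu> \<alpha> (\<lambda>y. complex_of_real (indicator (cell z) y)) x)"
    and x: "x \<in> cell z" and \<alpha>: "\<alpha> \<le> real CARD('n)"
  shows "(D ^ (3 * CARD('n))) powr (\<alpha> / real CARD('n) - 1) * measure \<mu> (cell z) powr (\<alpha> / real CARD('n))
    \<le> norm (frac_integral \<mu> \<alpha> (\<lambda>y. complex_of_real (indicator (cell z) y)) x)"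
proof -
  define a where "a = \<alpha> / real CARD('n)"
  have a: "a \<le> 1" using \<alpha> by (simp add: a_def)
  define M where "M = D ^ (3 * CARD('n))"
  have M: "0 < M" using D1 by (simp add: M_def)
  define m where "m = measure \<mu> (cell z)"
  have m: "0 < m" by (simp add: m_def cell_pos)
  let ?f = "frac_integrand \<mu> \<alpha> (\<lambda>y. complex_of_real (indicator (cell z) y)) x"
  have Re: "Re (?f y) = indicator (cell z) y * (1 / rect_vol \<mu> x y) powr (1 - a)" for y
    by (simp add: frac_integrand_def a_def)
  have "M powr (a - 1) * m powr a = (\<integral>y. (M * m) powr (a - 1) * indicator (cell z) y \<partial>\<mu>)"
    using m M by (simp add: m_def[symmetric] powr_mult powr_diff)
  also have "\<dots> \<le> (\<integral>y. Re (?f y) \<partial>\<mu>)"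
  proof (rule integral_mono_AE)
    show "integrable \<mu> (\<lambda>y. (M * m) powr (a - 1) * indicator (cell z) y)"
      using bounded_cell[of z] by (intro integrable_mult_right integrable_indicator_bounded) auto
    show "integrable \<mu> (\<lambda>y. Re (?f y))" using int by (rule integrable_Re)
    \<comment> \<open>If \<open>y\<close> shares a coordinate with \<open>x\<close>, the rectangle
      is degenerate, its volume is 0 and the kernel is 0 by convention, so the bound holds only
      almost everywhere.\<close>
    show "AE y in \<mu>. (M * m) powr (a - 1) * indicator (cell z) y \<le> Re (?f y)"
      using AE_coordinates_differ[of x]
    proof eventually_elim
      case (elim y)
      show ?case
      proof (cases "y \<in> cell z")
        case True
        have V: "0 < rect_vol \<mu> x y" using elim by (intro rect_vol_pos) auto
        have "rect_vol \<mu> x y \<le> M * m" unfolding M_def m_def by (rule rect_vol_le_cell[OF x True])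
        then have "(M * m) powr (a - 1) \<le> rect_vol \<mu> x y powr (a - 1)"
          using V a by (intro powr_mono2') auto
        also have "\<dots> = (1 / rect_vol \<mu> x y) powr (1 - a)"
          using V powr_minus_divide[of "rect_vol \<mu> x y" "1 - a"] by (simp add: powr_divide)
        finally show ?thesis using True by (simp add: Re)
      qed (simp add: Re)
    qed
  qed
  also have "\<dots> = Re (frac_integral \<mu> \<alpha> (\<lambda>y. complex_of_real (indicator (cell z) y)) x)"
    unfolding frac_integral_def using int by (rule integral_Re)
  also have "\<dots> \<le> norm (frac_integral \<mu> \<alpha> (\<lambda>y. complex_of_real (indicator (cell z) y)) x)"
    by (rule complex_Re_le_cmod)
  finally show ?thesis by (simp add: a_def M_def m_def)
qed

text \<open>Position 0 in every coordinate gives cubes with a common corner at the origin, which are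
  therefore nested.\<close>

definition cube_measure :: "int \<Rightarrow> real"
  where "cube_measure k = measure \<mu> (cell (\<lambda>_. (k, 0)))"

lemma cube_measure_growth: "(1 + 1 / D ^ 3) ^ j * cube_measure k \<le> cube_measure (k + int j)"
proof (induction j)
  case (Suc j)
  define l where "l = k + int j"
  have step: "(1 + 1 / D ^ 3) * cube_measure l \<le> cube_measure (l + 1)"
  proof -
    \<comment> \<open>Lengthening a single side, in an arbitrary coordinate, already gains the
      factor; the larger cube contains the result.\<close>
    obtain i :: 'n where True by blast
    define z :: "'n \<Rightarrow> int \<times> int" where "z = (\<lambda>_. (l, 0))"
    have zi: "z(i := (l, 0)) = z" by (auto simp: z_def)
    have "(1 + 1 / D ^ 3) * cube_measure l \<le> measure \<mu> (cell (z(i := (l + 1, 0))))"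
      using cell_reverse_doubling[of z i l 0] unfolding zi by (simp add: cube_measure_def z_def)
    also have "\<dots> \<le> cube_measure (l + 1)"
      unfolding cube_measure_def
    proof (intro measure_mono bounded_cell)
      have "(2::real) powi (l + 1) = 2 * 2 powi l" by (simp add: power_int_add)
      moreover have "(0::real) < 2 powi l" by simp
      ultimately have "(2::real) powi l \<le> 2 powi (l + 1)" by linarith
      then show "cell (z(i := (l + 1, 0))) \<subseteq> cell (\<lambda>_. (l + 1, 0))"
        by (auto simp: mem_cell_iff z_def split: if_splits) (metis less_le_trans)+
    qed simp
    finally show ?thesis .
  qed
  have "(1 + 1 / D ^ 3) ^ Suc j * cube_measure k = (1 + 1 / D ^ 3) * ((1 + 1 / D ^ 3) ^ j * cube_measure k)" by simp
  also have "\<dots> \<le> (1 + 1 / D ^ 3) * cube_measure l"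
    unfolding l_def using D1 Suc by (intro mult_left_mono) auto
  also have "\<dots> \<le> cube_measure (k + int (Suc j))" using step by (simp add: l_def add_ac)
  finally show ?case .
qed simp

text \<open>Growth is followed from level 0 upwards for \<open>s > 0\<close>, and from level
  \<open>- int j\<close> up to 0 for \<open>s < 0\<close>, where small masses give large
  powers.\<close>

lemma cube_measure_powr_unbounded:
  assumes "s \<noteq> 0"
  shows "\<exists>k. B < cube_measure k powr s"
proof -
  define \<rho> where "\<rho> = 1 + 1 / D ^ 3"
  have \<rho>: "1 < \<rho>" using D1 by (simp add: \<rho>_def)
  have pos: "0 < cube_measure k" for k by (simp add: cube_measure_def cell_pos)
  define t where "t = \<rho> powr \<bar>s\<bar>"
  have t: "1 < t" using \<rho> assms by (simp add: t_def)
  obtain j where j: "B / cube_measure 0 powr s < t ^ j" using real_arch_pow[OF t] by blast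
  have tj: "t ^ j = (\<rho> ^ j) powr \<bar>s\<bar>"
    using \<rho> by (simp add: t_def powr_powr mult.commute flip: powr_realpow)
  have B: "B < (\<rho> ^ j) powr \<bar>s\<bar> * cube_measure 0 powr s"
    using j pos[of 0] unfolding tj by (simp add: pos_divide_less_eq)
  show ?thesis
  proof (cases "s > 0")
    case True
    have "(\<rho> ^ j) powr \<bar>s\<bar> * cube_measure 0 powr s = (\<rho> ^ j * cube_measure 0) powr s"
      using True by (simp add: powr_mult)
    also have "\<dots> \<le> cube_measure (0 + int j) powr s"
      using cube_measure_growth[of j 0] True \<rho> pos[of 0] by (intro powr_mono2) (auto simp: \<rho>_def)
    finally have "B < cube_measure (0 + int j) powr s" using B by simp
    then show ?thesis by blast
  next
    case False
    have "cube_measure (- int j) * \<rho> ^ j \<le> cube_measure 0"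
      using cube_measure_growth[of j "- int j"] by (simp add: \<rho>_def mult.commute)
    then have "cube_measure 0 powr s \<le> (cube_measure (- int j) * \<rho> ^ j) powr s"
      using False \<rho> pos by (intro powr_mono2') auto
    also have "\<dots> = cube_measure (- int j) powr s * (\<rho> ^ j) powr s" by (simp add: powr_mult)
    finally have "(\<rho> ^ j) powr \<bar>s\<bar> * cube_measure 0 powr s \<le> (\<rho> ^ j) powr \<bar>s\<bar> * (cube_measure (- int j) powr s * (\<rho> ^ j) powr s)"
      by (rule mult_left_mono) simp
    also have "\<dots> = cube_measure (- int j) powr s * ((\<rho> ^ j) powr s * (\<rho> ^ j) powr \<bar>s\<bar>)" by simp
    also have "(\<rho> ^ j) powr s * (\<rho> ^ j) powr \<bar>s\<bar> = 1"
      using False \<rho> by (simp flip: powr_add)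
    finally have "B < cube_measure (- int j) powr s" using B by simp
    then show ?thesis by blast
  qed
qed

theorem frac_integral_bounded_imp_exponent:
  assumes \<alpha>: "\<alpha> \<le> real CARD('n)" and p: "0 < p" and q: "0 < q"
    and bound: "\<And>f. f \<in> Lp_space \<mu> p \<Longrightarrow>
            (AE x in \<mu>. integrable \<mu> (frac_integrand \<mu> \<alpha> f x)) \<and>
            frac_integral \<mu> \<alpha> f \<in> Lp_space \<mu> q \<and>
            Lp_norm \<mu> q (frac_integral \<mu> \<alpha> f) \<le> C * Lp_norm \<mu> p f"
  shows "\<alpha> / real CARD('n) = 1 / p - 1 / q"
proof (rule ccontr)
  define a where "a = \<alpha> / real CARD('n)"
  define M where "M = D ^ (3 * CARD('n))"
  have M: "0 < M" using D1 by (simp add: M_def)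
  assume "\<alpha> / real CARD('n) \<noteq> 1 / p - 1 / q"
  then have "a + 1 / q - 1 / p \<noteq> 0" by (simp add: a_def)
  \<comment> \<open>Testing on the indicator of a cube of mass \<open>m\<close> gives
    \<open>M powr (a - 1) * m powr (a + 1 / q - 1 / p) \<le> C\<close>; the level \<open>k\<close>
    is chosen to violate this.\<close>
  then obtain k where k: "C / M powr (a - 1) < cube_measure k powr (a + 1 / q - 1 / p)"
    using cube_measure_powr_unbounded by blast
  define z :: "'n \<Rightarrow> int \<times> int" where "z = (\<lambda>_. (k, 0))"
  define m where "m = measure \<mu> (cell z)"
  have m: "0 < m" "cube_measure k = m" by (auto simp: m_def cell_pos cube_measure_def z_def)
  define f where "f x = complex_of_real (indicator (cell z) x)" for x
  have f: "f \<in> Lp_space \<mu> p" "Lp_norm \<mu> p f = m powr (1 / p)"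
    unfolding f_def m_def by (rule indicator_cell_Lp[OF p])+
  define c where "c = M powr (a - 1) * m powr a"
  have c: "0 \<le> c" by (simp add: c_def)
  have "c powr q * m = (\<integral>x. c powr q * indicator (cell z) x \<partial>\<mu>)" by (simp add: m_def)
  also have "\<dots> \<le> (\<integral>x. norm (frac_integral \<mu> \<alpha> f x) powr q \<partial>\<mu>)"
  proof (rule integral_mono_AE)
    show "integrable \<mu> (\<lambda>x. c powr q * indicator (cell z) x)"
      using bounded_cell[of z] by (intro integrable_mult_right integrable_indicator_bounded) auto
    show "integrable \<mu> (\<lambda>x. norm (frac_integral \<mu> \<alpha> f x) powr q)"
      using bound[OF f(1)] by (simp add: Lp_space_def)
    have "AE x in \<mu>. integrable \<mu> (frac_integrand \<mu> \<alpha> f x)" using bound[OF f(1)] by simp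
    then show "AE x in \<mu>. c powr q * indicator (cell z) x \<le> norm (frac_integral \<mu> \<alpha> f x) powr q"
    proof eventually_elim
      case (elim x)
      show ?case
      proof (cases "x \<in> cell z")
        case True
        have "c \<le> norm (frac_integral \<mu> \<alpha> f x)"
          using frac_integral_indicator_cell_ge[OF elim[unfolded f_def] True \<alpha>]
          by (simp add: c_def M_def m_def a_def f_def[abs_def])
        then show ?thesis using True c q by (auto intro: powr_mono2)
      qed simp
    qed
  qed
  finally have "(c powr q * m) powr (1 / q) \<le> Lp_norm \<mu> q (frac_integral \<mu> \<alpha> f)"
    unfolding Lp_norm_def using q m by (intro powr_mono2) auto
  also have "\<dots> \<le> C * m powr (1 / p)" using bound[OF f(1)] f(2) by simp
  finally have "c * m powr (1 / q) \<le> C * m powr (1 / p)"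
    using c q m by (simp add: powr_mult powr_powr)
  then have "M powr (a - 1) * (m powr a * m powr (1 / q)) / m powr (1 / p) \<le> C"
    using m by (simp add: c_def pos_divide_le_eq mult_ac)
  moreover have "m powr a * m powr (1 / q) / m powr (1 / p) = m powr (a + 1 / q - 1 / p)"
    by (simp add: powr_add powr_diff)
  ultimately have "M powr (a - 1) * m powr (a + 1 / q - 1 / p) \<le> C"
    by (metis times_divide_eq_right)
  then have "m powr (a + 1 / q - 1 / p) \<le> C / M powr (a - 1)"
    using M by (simp add: pos_le_divide_eq mult.commute)
  with k m show False by simp
qed

end

section \<open>Application to weights and the equivalence\<close>

lemma rectangle_doubling_imp_rect_doubling_measure:
  fixes \<mu> :: "(real^'n) measure"
  assumes "rectangle_doubling \<mu>" and nz: "emeasure \<mu> UNIV \<noteq> 0"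
  obtains D where "rect_doubling_measure \<mu> D"
proof -
  from assms obtain \<omega> where w: "rectangle_doubling_weight \<omega>" and \<mu>: "\<mu> = density lebesgue (\<lambda>x. ennreal (\<omega> x))"
    unfolding rectangle_doubling_def by blast
  have \<omega>[measurable]: "\<omega> \<in> borel_measurable lebesgue" and \<omega>0: "\<And>x. 0 \<le> \<omega> x"
    and abs: "\<And>K. compact K \<Longrightarrow> \<omega> absolutely_integrable_on K"
    using w by (auto simp: rectangle_doubling_weight_def)
  obtain D where D: "1 \<le> D" "\<And>i c r E. 0 < r \<Longrightarrow> E \<in> sets borel \<Longrightarrow> (\<And>x t. subst_coord i x t \<in> E \<longleftrightarrow> x \<in> E) \<Longrightarrow>
      emeasure \<mu> (E \<inter> {x. \<bar>x $ i - c\<bar> \<le> 2 * r}) \<le> ennreal D * emeasure \<mu> (E \<inter> {x. \<bar>x $ i - c\<bar> \<le> r})"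
    using weight_doubling_in_coordinate[OF w] unfolding \<mu> by blast
  have fin: "emeasure \<mu> (closed_rect x \<delta>) < \<infinity>" for x \<delta>
  proof -
    have "integrable lebesgue (\<lambda>y. indicator (closed_rect x \<delta>) y *\<^sub>R \<omega> y)"
      using abs[of "closed_rect x \<delta>"] by (simp add: closed_rect_eq_cbox set_integrable_def)
    then have "(\<integral>\<^sup>+y. norm (indicator (closed_rect x \<delta>) y *\<^sub>R \<omega> y) \<partial>lebesgue) < \<infinity>"
      by (simp only: integrable_iff_bounded)
    also have "(\<integral>\<^sup>+y. norm (indicator (closed_rect x \<delta>) y *\<^sub>R \<omega> y) \<partial>lebesgue) = emeasure \<mu> (closed_rect x \<delta>)"
      unfolding \<mu> using \<omega>0 by (subst emeasure_density)
        (auto simp: closed_rect_eq_cbox indicator_def intro!: nn_integral_cong)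
    finally show ?thesis .
  qed
  have null: "{x. x $ i = c} \<in> null_sets \<mu>" for i c
  proof -
    have "{x::real^'n. x $ i = c} \<in> null_sets lebesgue"
      using negligible_standard_hyperplane[of "axis i 1 :: real^'n" c] by (simp add: negligible_iff_null_sets cart_eq_inner_axis)
    moreover from this have "AE x in lebesgue. x \<in> {x. x $ i = c} \<longrightarrow> ennreal (\<omega> x) = 0"
      by (rule AE_mp[OF AE_not_in]) simp
    ultimately show ?thesis unfolding \<mu> by (simp add: null_sets_density_iff null_setsD2)
  qed
  have "rect_doubling_measure \<mu> D"
    by standard (use D fin null nz in \<open>auto simp: \<mu>\<close>)
  then show thesis by (rule that)
qed

theorem mainTheorem1:
  fixes \<mu> :: "(real^'n) measure" and \<alpha> p q :: real
  assumes "rectangle_doubling \<mu>"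
    and "emeasure \<mu> UNIV \<noteq> 0"
    and "0 < \<alpha>" and "\<alpha> < real CARD('n)"
    and "1 < p" and "p < q"
  shows "(\<exists>C::real. \<forall>f \<in> Lp_space \<mu> p.
            (AE x in \<mu>. integrable \<mu> (frac_integrand \<mu> \<alpha> f x)) \<and>
            frac_integral \<mu> \<alpha> f \<in> Lp_space \<mu> q \<and>
            Lp_norm \<mu> q (frac_integral \<mu> \<alpha> f) \<le> C * Lp_norm \<mu> p f)
         \<longleftrightarrow> \<alpha> / real CARD('n) = 1 / p - 1 / q"
proof -
  obtain D where "rect_doubling_measure \<mu> D"
    using rectangle_doubling_imp_rect_doubling_measure[OF assms(1,2)] .
  then interpret rect_doubling_measure \<mu> D .
  show ?thesis
  proof
    assume "\<alpha> / real CARD('n) = 1 / p - 1 / q"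
    with assms show "\<exists>C::real. \<forall>f \<in> Lp_space \<mu> p.
            (AE x in \<mu>. integrable \<mu> (frac_integrand \<mu> \<alpha> f x)) \<and>
            frac_integral \<mu> \<alpha> f \<in> Lp_space \<mu> q \<and>
            Lp_norm \<mu> q (frac_integral \<mu> \<alpha> f) \<le> C * Lp_norm \<mu> p f"
      by (intro frac_integral_bounded)
  next
    assume "\<exists>C::real. \<forall>f \<in> Lp_space \<mu> p.
            (AE x in \<mu>. integrable \<mu> (frac_integrand \<mu> \<alpha> f x)) \<and>
            frac_integral \<mu> \<alpha> f \<in> Lp_space \<mu> q \<and>
            Lp_norm \<mu> q (frac_integral \<mu> \<alpha> f) \<le> C * Lp_norm \<mu> p f"
    then obtain C where "\<And>f. f \<in> Lp_space \<mu> p \<Longrightarrow>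
            (AE x in \<mu>. integrable \<mu> (frac_integrand \<mu> \<alpha> f x)) \<and>
            frac_integral \<mu> \<alpha> f \<in> Lp_space \<mu> q \<and>
            Lp_norm \<mu> q (frac_integral \<mu> \<alpha> f) \<le> C * Lp_norm \<mu> p f" by blast
    then show "\<alpha> / real CARD('n) = 1 / p - 1 / q"
      using assms by (intro frac_integral_bounded_imp_exponent) auto
  qed
qed

end
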